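(* Consider the generalized linear model with natural link and the $\ell_1$-type penalized maximum likelihood estimator $\hat{\boldsymbol\beta}_\lambda$ described in the context, with tuning parameter $\lambda_n=n^{(\gamma_0-2)/2}\lambda$, where $\lambda>0$ is fixed and $\gamma_0\in(1,2)$. Assume conditions (C1), (C2) on the regressors and (P1), (P2), (P3), (P4) on the penalty, as listed in the context. Then $\hat{\boldsymbol\beta}_\lambda$ has the sparsity property, i.e. $$\mathrm P\big(\hat{\boldsymbol\beta}_\lambda^{(1)}=\boldsymbol 0\big)\to 1\quad\text{as } n\to\infty,$$ where $\hat{\boldsymbol\beta}_\lambda^{(1)}=(\hat\beta_{\lambda,j})_{j:\,\beta^*_j=0}$ is the subvector of $\hat{\boldsymbol\beta}_\lambda$ corresponding to the zero components of the true parameter $\boldsymbol\beta^*$.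
   Context: Model. Let $f(\boldsymbol y;\boldsymbol\theta)=\exp\{\boldsymbol y^{\rm T}\boldsymbol\theta-a(\boldsymbol\theta)+b(\boldsymbol y)\}$ be a natural exponential family of densities on $\mathbb R^r$ with respect to a $\sigma$-finite measure, where $\boldsymbol\theta\in\Theta\subset\mathbb R^r$ and $\Theta$ is the natural parameter space (those $\boldsymbol\theta$ for which the normalizing integral of $\exp\{\boldsymbol y^{\rm T}\boldsymbol\theta+b(\boldsymbol y)\}$ is positive and finite); $\Theta^\circ$ is its interior. It is assumed that $\mathrm V[\boldsymbol y]=a''(\boldsymbol\theta)$ is positive definite (primes denote gradient and Hessian). The data are $(\boldsymbol y_i,\boldsymbol X_i)$, $i=1,\dots,n$, with $\boldsymbol y_i$ independent $r$-dimensional random vectors and $\boldsymbol X_i\in\mathcal X\subset\mathbb R^{r\times p}$ known constant matrices; $\boldsymbol y_i$ has density $f(\cdot;\boldsymbol X_i\boldsymbol\beta^* )$, where $\boldsymbol\beta^*\in\mathcal B$ is the true parameter and $\mathcal B\subset\mathbb R^p$ is an open convex set; $p$ and $r$ are fixed and $n\to\infty$. The log-likelihood of $\boldsymbol y_i$ is $g_i(\boldsymbol\beta)=\boldsymbol y_i^{\rm T}\boldsymbol X_i\boldsymbol\beta-a(\boldsymbol X_i\boldsymbol\beta)+b(\boldsymbol y_i)$. Conditions on regressors. (C1) $\mathcal X$ is compact and $\boldsymbol X\boldsymbol\beta\in\Theta^\circ$ for all $\boldsymbol X\in\mathcal X$, $\boldsymbol\beta\in\mathcal B$. (C2) There exists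 an invariant distribution $\mu$ on $\mathcal X$; in particular, $n^{-1}\sum_{i=1}^n\boldsymbol X_i^{\rm T}a''(\boldsymbol X_i\boldsymbol\beta)\boldsymbol X_i$ converges to a positive-definite matrix $\boldsymbol J(\boldsymbol\beta)=\int_{\mathcal X}\boldsymbol X^{\rm T}a''(\boldsymbol X\boldsymbol\beta)\boldsymbol X\,\mu(\mathrm d\boldsymbol X)$. Estimator. $\hat{\boldsymbol\beta}_\lambda=\mathrm{argmin}_{\boldsymbol\beta\in\mathcal B}\{-\sum_{i=1}^n g_i(\boldsymbol\beta)+n\sum_{j=1}^p\eta_{\lambda_n}(\beta_j)\}$, where $\eta_{\lambda_n}$ is a (not necessarily convex) penalty function. Conditions on the penalty. (P1) $\eta_{\lambda_n}(\beta)$ is non-differentiable only at the origin, symmetric about $\beta=0$, and monotone non-decreasing in $|\beta|$. (P2) $\lim_{\beta\to0}\eta_{\lambda_n}(\beta)/|\beta|=\lambda_n$ (this is understood to imply $\eta_{\lambda_n}(0)=0$ and $\lim_{\beta\to0}\eta'_{\lambda_n}(\beta)/\mathrm{sgn}(\beta)=\lambda_n$). (P3) $\lim_{n\to\infty}\eta_{\lambda_n}(\beta)=0$ for any $\beta$. (P4) There exists $\tau>0$ such that $\eta'_{\lambda_n}(\beta)=0$ for any $|\beta|\ge\tau\lambda_n$.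
   Formalization: The limit in (P2) is assumed uniform in n, with β and the error measured relative to λ_n (automatic for SCAD and MCP); with the limit taken only for each n separately, the penalty's slope may be confined to a negligible neighbourhood of 0 and sparsity fails. *)

theory Defs
  imports "HOL-Probability.Probability"
begin

section \<open>Natural exponential families\<close>

definition natural_parameter_space ::
  "(real^'r) measure \<Rightarrow> (real^'r \<Rightarrow> real) \<Rightarrow> (real^'r) set" where
  "natural_parameter_space \<nu> b =
     {\<theta>. 0 < (\<integral>\<^sup>+ y. ennreal (exp (y \<bullet> \<theta> + b y)) \<partial>\<nu>) \<and>
          (\<integral>\<^sup>+ y. ennreal (exp (y \<bullet> \<theta> + b y)) \<partial>\<nu>) < \<infinity>}"

text \<open>The function \<open>a\<close> is not a free parameter: on the natural parameter space it is
  determined by the requirement that \<open>nef_density\<close> integrates to one.\<close>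

definition log_partition ::
  "(real^'r) measure \<Rightarrow> (real^'r \<Rightarrow> real) \<Rightarrow> real^'r \<Rightarrow> real" where
  "log_partition \<nu> b \<theta> = ln (\<integral> y. exp (y \<bullet> \<theta> + b y) \<partial>\<nu>)"

definition nef_density ::
  "(real^'r) measure \<Rightarrow> (real^'r \<Rightarrow> real) \<Rightarrow> real^'r \<Rightarrow> real^'r \<Rightarrow> real" where
  "nef_density \<nu> b \<theta> y = exp (y \<bullet> \<theta> - log_partition \<nu> b \<theta> + b y)"

definition positive_definite :: "real^'m^'m \<Rightarrow> bool" where
  "positive_definite A \<longleftrightarrow> transpose A = A \<and> (\<forall>v. v \<noteq> 0 \<longrightarrow> 0 < v \<bullet> (A *v v))"

definition gradient_hessian_on ::
  "(real^'m) set \<Rightarrow> (real^'m \<Rightarrow> real) \<Rightarrow> (real^'m \<Rightarrow> real^'m) \<Rightarrow> (real^'m \<Rightarrow> real^'m^'m) \<Rightarrow> bool" where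
  "gradient_hessian_on S f f' f'' \<longleftrightarrow>
     (\<forall>x\<in>S. GDERIV f x :> f' x \<and> (f' has_derivative (\<lambda>h. f'' x *v h)) (at x))"


section \<open>Conditions on the regressors\<close>

text \<open>Throughout, the sample of size \<open>n\<close> consists of the observations with index \<open>i < n\<close>.\<close>

definition regressors_admissible ::
  "(real^'r) set \<Rightarrow> (real^'p^'r) set \<Rightarrow> (real^'p) set \<Rightarrow> bool" where
  "regressors_admissible \<Theta> \<X> B \<longleftrightarrow>
     compact \<X> \<and> (\<forall>Z\<in>\<X>. \<forall>\<beta>\<in>B. Z *v \<beta> \<in> interior \<Theta>)"

definition limit_information ::
  "(real^'r \<Rightarrow> real^'r^'r) \<Rightarrow> (real^'p^'r) measure \<Rightarrow> real^'p \<Rightarrow> real^'p^'p" where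
  "limit_information a'' \<mu> \<beta> = (\<integral> Z. transpose Z ** a'' (Z *v \<beta>) ** Z \<partial>\<mu>)"

definition regressors_stable ::
  "(real^'r \<Rightarrow> real^'r^'r) \<Rightarrow> (real^'p^'r) set \<Rightarrow> (real^'p) set \<Rightarrow> (nat \<Rightarrow> real^'p^'r) \<Rightarrow> bool" where
  "regressors_stable a'' \<X> B X \<longleftrightarrow>
     (\<exists>\<mu>. prob_space \<mu> \<and> sets \<mu> = sets (restrict_space borel \<X>) \<and>
       (\<forall>\<beta>\<in>B.
         positive_definite (limit_information a'' \<mu> \<beta>) \<and>
         (\<lambda>n. (1 / real n) *\<^sub>R (\<Sum>i<n. transpose (X i) ** a'' (X i *v \<beta>) ** X i))
           \<longlonglongrightarrow> limit_information a'' \<mu> \<beta>))"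


section \<open>Conditions on the penalty\<close>

text \<open>The family of penalties is \<open>\<eta> :: real \<Rightarrow> real \<Rightarrow> real\<close>, the first argument being the tuning
  parameter; \<open>l n\<close> is the tuning parameter used for sample size \<open>n\<close>.\<close>

definition penalty_shape :: "(nat \<Rightarrow> real) \<Rightarrow> (real \<Rightarrow> real \<Rightarrow> real) \<Rightarrow> bool" where
  "penalty_shape l \<eta> \<longleftrightarrow> (\<forall>n\<ge>1.
     (\<forall>\<beta>. \<eta> (l n) field_differentiable (at \<beta>) \<longleftrightarrow> \<beta> \<noteq> 0) \<and>
     (\<forall>\<beta>. \<eta> (l n) (- \<beta>) = \<eta> (l n) \<beta>) \<and>
     (\<forall>\<beta> \<beta>'. \<bar>\<beta>\<bar> \<le> \<bar>\<beta>'\<bar> \<longrightarrow> \<eta> (l n) \<beta> \<le> \<eta> (l n) \<beta>'))"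

text \<open>The limit of \<open>\<eta> (l n) \<beta> / \<bar>\<beta>\<bar>\<close> as \<open>\<beta>\<close> tends to \<open>0\<close> is understood to be uniform in \<open>n\<close>,
  with \<open>\<beta>\<close> and the error both measured relative to \<open>l n\<close>; this is the last conjunct.
  For scale families \<open>\<eta> t \<beta> = t\<^sup>2 * \<rho> (\<beta> / t)\<close>, such as SCAD and MCP, uniformity is automatic.
  With a limit taken separately for each \<open>n\<close> the slope \<open>l n\<close> could be confined to
  an interval around \<open>0\<close> that shrinks arbitrarily fast with \<open>n\<close>; the penalty would then have no
  effect on the estimator asymptotically, and sparsity would fail.\<close>

definition penalty_slope_at_zero :: "(nat \<Rightarrow> real) \<Rightarrow> (real \<Rightarrow> real \<Rightarrow> real) \<Rightarrow> bool" where
  "penalty_slope_at_zero l \<eta> \<longleftrightarrow>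
     (\<forall>n\<ge>1.
        ((\<lambda>\<beta>. \<eta> (l n) \<beta> / \<bar>\<beta>\<bar>) \<longlongrightarrow> l n) (at 0) \<and>
        \<eta> (l n) 0 = 0 \<and>
        ((\<lambda>\<beta>. deriv (\<eta> (l n)) \<beta> / sgn \<beta>) \<longlongrightarrow> l n) (at 0)) \<and>
     (\<forall>\<epsilon>>0. \<exists>\<delta>>0. \<forall>n\<ge>1. \<forall>\<beta>. 0 < \<bar>\<beta>\<bar> \<and> \<bar>\<beta>\<bar> \<le> \<delta> * l n \<longrightarrow>
        \<bar>\<eta> (l n) \<beta> / \<bar>\<beta>\<bar> - l n\<bar> \<le> \<epsilon> * l n)"

definition penalty_vanishing :: "(nat \<Rightarrow> real) \<Rightarrow> (real \<Rightarrow> real \<Rightarrow> real) \<Rightarrow> bool" where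
  "penalty_vanishing l \<eta> \<longleftrightarrow> (\<forall>\<beta>. (\<lambda>n. \<eta> (l n) \<beta>) \<longlonglongrightarrow> 0)"

definition penalty_eventually_flat :: "(nat \<Rightarrow> real) \<Rightarrow> (real \<Rightarrow> real \<Rightarrow> real) \<Rightarrow> bool" where
  "penalty_eventually_flat l \<eta> \<longleftrightarrow>
     (\<exists>\<tau>>0. \<forall>n\<ge>1. \<forall>\<beta>. \<tau> * l n \<le> \<bar>\<beta>\<bar> \<longrightarrow> deriv (\<eta> (l n)) \<beta> = 0)"


section \<open>The estimator\<close>

definition tuning :: "real \<Rightarrow> real \<Rightarrow> nat \<Rightarrow> real" where
  "tuning \<gamma>0 lam n = real n powr ((\<gamma>0 - 2) / 2) * lam"

definition log_lik ::
  "(real^'r) measure \<Rightarrow> (real^'r \<Rightarrow> real) \<Rightarrow> real^'p^'r \<Rightarrow> real^'r \<Rightarrow> real^'p \<Rightarrow> real" where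
  "log_lik \<nu> b Z y \<beta> = y \<bullet> (Z *v \<beta>) - log_partition \<nu> b (Z *v \<beta>) + b y"

definition penalized_objective ::
  "(real^'r) measure \<Rightarrow> (real^'r \<Rightarrow> real) \<Rightarrow> (real \<Rightarrow> real) \<Rightarrow>
   (nat \<Rightarrow> real^'p^'r) \<Rightarrow> (nat \<Rightarrow> real^'r) \<Rightarrow> nat \<Rightarrow> real^'p \<Rightarrow> real" where
  "penalized_objective \<nu> b pen X y n \<beta> =
     - (\<Sum>i<n. log_lik \<nu> b (X i) (y i) \<beta>) + real n * (\<Sum>j\<in>UNIV. pen (\<beta> $ j))"

text \<open>The parameter set \<open>B\<close> is open, so a minimizer need not exist for every sample
  (as in logistic regression with separated data). The estimator is
  therefore any measurable map that picks a minimizer whenever there is one; on the remaining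
  samples its value is arbitrary.\<close>

definition penalized_mle ::
  "'w measure \<Rightarrow> (real^'r) measure \<Rightarrow> (real^'r \<Rightarrow> real) \<Rightarrow> (real^'p) set \<Rightarrow> (nat \<Rightarrow> real) \<Rightarrow>
   (real \<Rightarrow> real \<Rightarrow> real) \<Rightarrow> (nat \<Rightarrow> real^'p^'r) \<Rightarrow> (nat \<Rightarrow> 'w \<Rightarrow> real^'r) \<Rightarrow>
   (nat \<Rightarrow> 'w \<Rightarrow> real^'p) \<Rightarrow> bool" where
  "penalized_mle M \<nu> b B l \<eta> X Y \<beta>hat \<longleftrightarrow> (\<forall>n\<ge>1.
     \<beta>hat n \<in> borel_measurable M \<and>
     (\<forall>\<omega>\<in>space M.
        let Q = penalized_objective \<nu> b (\<eta> (l n)) X (\<lambda>i. Y i \<omega>) n in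
        (\<exists>\<beta>. is_arg_min Q (\<lambda>\<beta>. \<beta> \<in> B) \<beta>) \<longrightarrow> is_arg_min Q (\<lambda>\<beta>. \<beta> \<in> B) (\<beta>hat n \<omega>)))"

end

theory Submission
  imports Defs
begin

text \<open>Let \<open>l = tuning \<gamma>0 lam n\<close> and let \<open>W\<close> be the score at \<open>\<beta>star\<close>. By Chebyshev's inequality the event
  \<open>\<bar>W\<bar> \<le> \<kappa> n l\<close> has probability tending to one for every fixed \<open>\<kappa> > 0\<close>, because \<open>W\<close> has
  variance of order \<open>n\<close> and \<open>n l\<^sup>2\<close> tends to infinity. On this event, and for large \<open>n\<close>,
  everything is deterministic. The negative log-likelihood is convex and near \<open>\<beta>star\<close> it exceeds its
  value there by at least \<open>c n d\<^sup>2 - \<kappa> n l d\<close> at distance \<open>d\<close>; the penalty is uniformly \<open>o(1)\<close>, so a minimizer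
  exists and all minimizers lie near \<open>\<beta>star\<close>. There the penalty of the nonzero components is
  constant, hence the penalty cannot make up for a loss in likelihood and \<open>d \<le> \<kappa> l / c\<close>.
  At this distance the gradient of the negative log-likelihood is at most \<open>\<kappa> n l (1 + C / c)\<close>, whereas the
  penalty grows with slope at least \<open>n l / 2\<close> in every component that should vanish. For small \<open>\<kappa>\<close>
  a nonzero value of such a component is therefore not optimal.

  The constants \<open>c\<close> and \<open>C\<close> require \<open>a''\<close> to be continuous, which is not assumed: it follows by
  writing \<open>a''\<close> as the covariance of the family and differentiating under the integral sign.\<close>

section \<open>Exponential moments\<close>

text \<open>Between 0 and \<open>x\<close> the derivative of \<open>exp\<close> is at most the
  larger of 1 and \<open>exp x\<close>; their sum spares later case distinctions. Multiplied by a
  tilt at one end of an increment, the factor \<open>1 + exp x\<close> becomes the sum of the tilts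
  at both ends, which suits the domination of difference quotients.\<close>

lemma abs_exp_minus_one_le: "\<bar>exp x - 1\<bar> \<le> \<bar>x\<bar> * (1 + exp x)" for x :: real
proof (cases "x \<ge> 0")
  case True
  have "1 + - x \<le> exp (- x)"
    by (rule exp_ge_add_one_self)
  then have "(1 + - x) * exp x \<le> exp (- x) * exp x"
    by (intro mult_right_mono) auto
  then have "exp x - 1 \<le> x * exp x"
    by (simp add: exp_minus algebra_simps)
  then show ?thesis
    using True by (simp add: algebra_simps)
next
  case False
  then have *: "x * exp x \<le> 0"
    by (simp add: mult_nonpos_nonneg)
  show ?thesis
  proof -
    have "\<bar>exp x - 1\<bar> = 1 - exp x" "\<bar>x\<bar> = - x"
      using False by auto
    moreover have "1 - exp x \<le> - x - x * exp x"
      using * exp_ge_add_one_self[of x] by linarith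
    ultimately show ?thesis
      by (simp add: algebra_simps)
  qed
qed

text \<open>This isolates the setting for differentiation under the integral sign: an open set of
  parameters at which the tilts are integrable. Positivity of the integrals and the log-partition
  function enter only later.\<close>

locale exp_tilt =
  fixes \<nu> :: "'a::euclidean_space measure" and b :: "'a \<Rightarrow> real" and U :: "'a set"
  assumes sets_base [measurable_cong]: "sets \<nu> = sets borel"
    and b_measurable [measurable]: "b \<in> borel_measurable borel"
    and open_U: "open U"
    and integrable_exp: "\<theta> \<in> U \<Longrightarrow> integrable \<nu> (\<lambda>y. exp (y \<bullet> \<theta> + b y))"
begin

text \<open>Integrability is required on all of \<open>U\<close> rather than at a single parameter.
  This makes the class closed under multiplication by linear functionals, so it contains the
  integrands of first and second moments.\<close>

definition admissible :: "('a \<Rightarrow> real) \<Rightarrow> bool" where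
  "admissible g \<longleftrightarrow> g \<in> borel_measurable borel \<and>
     (\<forall>\<theta>\<in>U. integrable \<nu> (\<lambda>y. g y * exp (y \<bullet> \<theta> + b y)))"

definition tilted_moment :: "('a \<Rightarrow> real) \<Rightarrow> 'a \<Rightarrow> real" where
  "tilted_moment g \<theta> = (\<integral> y. g y * exp (y \<bullet> \<theta> + b y) \<partial>\<nu>)"

lemma admissible_const: "admissible (\<lambda>_. c)"
  unfolding admissible_def using integrable_exp by auto

text \<open>A linear factor is absorbed by exponentials:
  \<open>\<bar>x\<bar> \<le> exp x + exp (- x)\<close> with \<open>x = s * (y \<bullet> v)\<close>,
  and the two exponentials merely move the parameter to \<theta> plus or minus a small multiple of
  \<open>v\<close>, where \<open>g\<close> is still integrable.\<close>

lemma admissible_mult_inner: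
  assumes g: "admissible g"
  shows "admissible (\<lambda>y. g y * (y \<bullet> v))"
  unfolding admissible_def
proof (intro conjI ballI)
  have [measurable]: "g \<in> borel_measurable borel"
    using g by (simp add: admissible_def)
  show "(\<lambda>y. g y * (y \<bullet> v)) \<in> borel_measurable borel"
    by measurable
  fix \<theta> assume \<theta>: "\<theta> \<in> U"
  then obtain e where e: "e > 0" "cball \<theta> e \<subseteq> U"
    using open_U open_contains_cball by blast
  \<comment> \<open>The summand 1 covers the case \<open>v = 0\<close>; always
    \<open>s * norm v \<le> e\<close>, which keeps both shifted parameters in
    \<open>U\<close>.\<close>
  define s where "s = e / (norm v + 1)"
  have s: "s > 0"
    using e by (auto simp: s_def add_nonneg_pos)
  have "s * norm v \<le> e"
  proof -
    have "s * norm v \<le> s * (norm v + 1)"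
      using s by (intro mult_left_mono) auto
    also have "\<dots> = e"
      using e norm_ge_zero[of v] by (simp add: s_def field_simps add_nonneg_eq_0_iff)
    finally show ?thesis .
  qed
  then have "\<theta> + s *\<^sub>R v \<in> U" "\<theta> - s *\<^sub>R v \<in> U"
    using e s by (auto intro!: subsetD[OF e(2)] simp: dist_norm)
  then have int: "integrable \<nu> (\<lambda>y. g y * exp (y \<bullet> (\<theta> + s *\<^sub>R v) + b y))"
    "integrable \<nu> (\<lambda>y. g y * exp (y \<bullet> (\<theta> - s *\<^sub>R v) + b y))"
    using g by (auto simp: admissible_def)
  show "integrable \<nu> (\<lambda>y. g y * (y \<bullet> v) * exp (y \<bullet> \<theta> + b y))"
  proof (rule Bochner_Integration.integrable_bound)
    show "integrable \<nu> (\<lambda>y. (1/s) * (\<bar>g y * exp (y \<bullet> (\<theta> + s *\<^sub>R v) + b y)\<bar>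
        + \<bar>g y * exp (y \<bullet> (\<theta> - s *\<^sub>R v) + b y)\<bar>))"
      by (intro integrable_mult_right Bochner_Integration.integrable_add integrable_abs int)
    show "AE y in \<nu>. norm (g y * (y \<bullet> v) * exp (y \<bullet> \<theta> + b y)) \<le>
       norm ((1/s) * (\<bar>g y * exp (y \<bullet> (\<theta> + s *\<^sub>R v) + b y)\<bar>
        + \<bar>g y * exp (y \<bullet> (\<theta> - s *\<^sub>R v) + b y)\<bar>))"
    proof (rule AE_I2)
      fix y
      have "\<bar>s * (y \<bullet> v)\<bar> \<le> exp (s * (y \<bullet> v)) + exp (- (s * (y \<bullet> v)))" (is "_ \<le> ?E")
        using exp_ge_add_one_self[of "s * (y \<bullet> v)"] exp_ge_add_one_self[of "- (s * (y \<bullet> v))"]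
          exp_gt_zero[of "s * (y \<bullet> v)"] exp_gt_zero[of "- (s * (y \<bullet> v))"]
        by linarith
      then have "\<bar>y \<bullet> v\<bar> \<le> (1/s) * ?E"
        using s by (simp add: abs_mult field_simps)
      then have "\<bar>g y\<bar> * exp (y \<bullet> \<theta> + b y) * \<bar>y \<bullet> v\<bar> \<le> \<bar>g y\<bar> * exp (y \<bullet> \<theta> + b y) * ((1/s) * ?E)"
        by (intro mult_left_mono) auto
      also have "\<dots> = (1/s) * (\<bar>g y * exp (y \<bullet> (\<theta> + s *\<^sub>R v) + b y)\<bar>
        + \<bar>g y * exp (y \<bullet> (\<theta> - s *\<^sub>R v) + b y)\<bar>)"
        by (simp add: abs_mult inner_add_right inner_diff_right exp_add exp_diff exp_minus
            algebra_simps divide_inverse)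
      finally show "norm (g y * (y \<bullet> v) * exp (y \<bullet> \<theta> + b y)) \<le> norm ((1/s) *
          (\<bar>g y * exp (y \<bullet> (\<theta> + s *\<^sub>R v) + b y)\<bar> + \<bar>g y * exp (y \<bullet> (\<theta> - s *\<^sub>R v) + b y)\<bar>))"
        using s by (simp add: abs_mult algebra_simps)
    qed
  qed measurable
qed

lemma admissible_inner: "admissible (\<lambda>y. y \<bullet> v)"
  using admissible_mult_inner[OF admissible_const[of 1], of v] by simp

text \<open>Near \<open>\<theta>\<close> the tilts are dominated by the sum of the tilts at the vertices of a small cube,
  because a linear functional attains its maximum over the cube at a vertex.\<close>

lemma exp_dominated_nearby:
  assumes "\<theta> \<in> U"
  obtains d S where "d > 0" "cball \<theta> d \<subseteq> U" "finite S" "S \<subseteq> U"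
    "\<And>\<phi> y. \<phi> \<in> cball \<theta> d \<Longrightarrow> exp (y \<bullet> \<phi>) \<le> (\<Sum>s\<in>S. exp (y \<bullet> s))"
proof -
  obtain e where e: "e > 0" "cball \<theta> e \<subseteq> U"
    using assms open_U open_contains_cball by blast
  \<comment> \<open>By comparison of the Euclidean norm with the l1 norm, the cube of half-side
    \<open>d\<close> lies in the ball of radius \<open>e\<close>; it also contains the ball of
    radius \<open>d\<close>.\<close>
  define d where "d = e / DIM('a)"
  have d: "d > 0"
    using e by (simp add: d_def)
  let ?d = "\<Sum>i\<in>Basis. d *\<^sub>R i :: 'a"
  have di: "?d \<bullet> i = d" if "i \<in> Basis" for i
    using that by (simp add: inner_sum_left inner_Basis if_distrib cong: if_cong)
  obtain S :: "'a set" where S: "finite S" "cbox (\<theta> - ?d) (\<theta> + ?d) = convex hull S"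
    using cube_convex_hull[OF d] by metis
  have box: "cbox (\<theta> - ?d) (\<theta> + ?d) \<subseteq> cball \<theta> e"
  proof
    fix x assume x: "x \<in> cbox (\<theta> - ?d) (\<theta> + ?d)"
    have "norm (x - \<theta>) \<le> (\<Sum>i\<in>Basis. \<bar>(x - \<theta>) \<bullet> i\<bar>)"
      by (rule norm_le_l1)
    also have "\<dots> \<le> (\<Sum>i\<in>(Basis::'a set). d)"
      using x by (intro sum_mono) (auto simp: mem_box inner_diff_left inner_add_left di abs_le_iff algebra_simps)
    also have "\<dots> = e"
      by (simp add: d_def)
    finally show "x \<in> cball \<theta> e"
      by (simp add: dist_norm norm_minus_commute)
  qed
  have ball: "cball \<theta> d \<subseteq> cbox (\<theta> - ?d) (\<theta> + ?d)"
  proof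
    fix x assume "x \<in> cball \<theta> d"
    then have "\<bar>(x - \<theta>) \<bullet> i\<bar> \<le> d" if "i \<in> Basis" for i
      using Basis_le_norm[OF that, of "x - \<theta>"] by (simp add: dist_norm norm_minus_commute)
    then show "x \<in> cbox (\<theta> - ?d) (\<theta> + ?d)"
      by (auto simp: mem_box inner_diff_left inner_add_left di abs_le_iff algebra_simps)
  qed
  show thesis
  proof (rule that[of d S])
    show "cball \<theta> d \<subseteq> U"
      using ball box e by blast
    show "S \<subseteq> U"
      using S(2) hull_subset[of S convex] box e by blast
    fix \<phi> y assume "\<phi> \<in> cball \<theta> d"
    then have \<phi>: "\<phi> \<in> convex hull S"
      using ball S by blast
    then have ne: "S \<noteq> {}"
      by auto
    define m where "m = Max ((\<lambda>s. y \<bullet> s) ` S)"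
    obtain s where s: "s \<in> S" "m = y \<bullet> s"
      using Max_in[of "(\<lambda>s. y \<bullet> s) ` S"] S(1) ne unfolding m_def by blast
    have "convex hull S \<subseteq> {x. y \<bullet> x \<le> m}"
      using S(1) by (intro hull_minimal convex_halfspace_le) (auto simp: m_def)
    then have "exp (y \<bullet> \<phi>) \<le> exp (y \<bullet> s)"
      using \<phi> s by auto
    also have "\<dots> \<le> (\<Sum>s\<in>S. exp (y \<bullet> s))"
      using s S(1) by (intro member_le_sum) auto
    finally show "exp (y \<bullet> \<phi>) \<le> (\<Sum>s\<in>S. exp (y \<bullet> s))" .
  qed (use S d in auto)
qed

lemma integrable_dominating:
  assumes "admissible g" "finite S" "S \<subseteq> U"
  shows "integrable \<nu> (\<lambda>y. \<bar>g y\<bar> * (\<Sum>s\<in>S. exp (y \<bullet> s)) * exp (b y))"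
proof -
  have "integrable \<nu> (\<lambda>y. \<Sum>s\<in>S. \<bar>g y * exp (y \<bullet> s + b y)\<bar>)"
    using assms by (intro Bochner_Integration.integrable_sum integrable_abs) (auto simp: admissible_def)
  then show ?thesis
    by (simp add: abs_mult exp_add sum_distrib_left sum_distrib_right mult.assoc)
qed

lemma continuous_on_tilted_moment:
  assumes g: "admissible g"
  shows "continuous_on U (tilted_moment g)"
  unfolding continuous_on_sequentially
proof (intro allI ballI impI)
  fix x \<theta> assume \<theta>: "\<theta> \<in> U" and x: "(\<forall>n. x n \<in> U) \<and> x \<longlonglongrightarrow> \<theta>"
  have [measurable]: "g \<in> borel_measurable borel"
    using g by (simp add: admissible_def)
  obtain d S where dS: "d > 0" "cball \<theta> d \<subseteq> U" "finite S" "S \<subseteq> U"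
    "\<And>\<phi> y. \<phi> \<in> cball \<theta> d \<Longrightarrow> exp (y \<bullet> \<phi>) \<le> (\<Sum>s\<in>S. exp (y \<bullet> s))"
    using exp_dominated_nearby[OF \<theta>] by blast
  \<comment> \<open>The dominating function is valid only on the small ball, so the sequence is
    considered from index \<open>N\<close> on.\<close>
  obtain N where N: "\<And>n. n \<ge> N \<Longrightarrow> dist (x n) \<theta> < d"
    using x dS(1) by (meson lim_sequentially)
  have "(\<lambda>n. tilted_moment g (x (n + N))) \<longlonglongrightarrow> tilted_moment g \<theta>"
    unfolding tilted_moment_def
  proof (rule integral_dominated_convergence)
    show "integrable \<nu> (\<lambda>y. \<bar>g y\<bar> * (\<Sum>s\<in>S. exp (y \<bullet> s)) * exp (b y))"
      using g dS by (intro integrable_dominating)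
    have "(\<lambda>n. x (n + N)) \<longlonglongrightarrow> \<theta>"
      using x by (simp add: LIMSEQ_ignore_initial_segment)
    then show "AE y in \<nu>. (\<lambda>n. g y * exp (y \<bullet> x (n + N) + b y)) \<longlonglongrightarrow> g y * exp (y \<bullet> \<theta> + b y)"
      by (intro AE_I2 tendsto_intros)
    show "AE y in \<nu>. norm (g y * exp (y \<bullet> x (n + N) + b y)) \<le> \<bar>g y\<bar> * (\<Sum>s\<in>S. exp (y \<bullet> s)) * exp (b y)" for n
    proof (rule AE_I2)
      fix y
      have "exp (y \<bullet> x (n + N)) \<le> (\<Sum>s\<in>S. exp (y \<bullet> s))"
        using N[of "n + N"] by (intro dS(5)) (simp add: dist_commute)
      then show "norm (g y * exp (y \<bullet> x (n + N) + b y)) \<le> \<bar>g y\<bar> * (\<Sum>s\<in>S. exp (y \<bullet> s)) * exp (b y)"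
        by (simp add: abs_mult exp_add mult_mono mult.assoc)
    qed
  qed measurable
  then show "(tilted_moment g \<circ> x) \<longlonglongrightarrow> tilted_moment g \<theta>"
    unfolding comp_def by (rule LIMSEQ_offset)
qed

text \<open>Differentiation under the integral sign: by the bound on \<open>exp x - 1\<close> the
  difference quotient is at most \<open>\<bar>g y * (y \<bullet> v)\<bar>\<close> times the sum of
  the tilts at \<theta> and at the shifted parameter, and near \<theta> these have a common
  integrable bound.\<close>

lemma has_real_derivative_tilted_moment:
  assumes g: "admissible g" and \<theta>: "\<theta> \<in> U"
  shows "((\<lambda>t. tilted_moment g (\<theta> + t *\<^sub>R v)) has_real_derivative
           tilted_moment (\<lambda>y. g y * (y \<bullet> v)) \<theta>) (at 0)"
  unfolding DERIV_def tendsto_at_iff_sequentially comp_def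
proof (intro allI impI)
  fix h :: "nat \<Rightarrow> real"
  assume h0: "\<forall>i. h i \<in> UNIV - {0}" and h: "h \<longlonglongrightarrow> 0"
  have g' [measurable]: "g \<in> borel_measurable borel"
    using g by (simp add: admissible_def)
  obtain d S where dS: "d > 0" "cball \<theta> d \<subseteq> U" "finite S" "S \<subseteq> U"
    "\<And>\<phi> y. \<phi> \<in> cball \<theta> d \<Longrightarrow> exp (y \<bullet> \<phi>) \<le> (\<Sum>s\<in>S. exp (y \<bullet> s))"
    using exp_dominated_nearby[OF \<theta>] by blast
  have "(\<lambda>n. \<theta> + h n *\<^sub>R v) \<longlonglongrightarrow> \<theta> + 0 *\<^sub>R v"
    by (intro tendsto_intros h)
  then obtain N where N: "\<And>n. n \<ge> N \<Longrightarrow> dist (\<theta> + h n *\<^sub>R v) \<theta> < d"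
    using dS(1) unfolding lim_sequentially by (metis add.right_neutral scale_zero_left)
  let ?W = "\<lambda>y. \<bar>g y * (y \<bullet> v)\<bar> * (\<Sum>s\<in>S. exp (y \<bullet> s)) * exp (b y)"
  let ?s = "\<lambda>n y. (g y * exp (y \<bullet> (\<theta> + h n *\<^sub>R v) + b y) - g y * exp (y \<bullet> \<theta> + b y)) / h n"
  have hN: "h n \<noteq> 0" for n
    using h0 by auto
  have W: "integrable \<nu> ?W"
    using g dS by (intro integrable_dominating admissible_mult_inner)
  have "(\<lambda>n. integral\<^sup>L \<nu> (?s (n + N))) \<longlonglongrightarrow> tilted_moment (\<lambda>y. g y * (y \<bullet> v)) \<theta>"
    unfolding tilted_moment_def
  proof (rule integral_dominated_convergence)
    \<comment> \<open>The factor 2 accounts for the two ends of the increment, whose tilts are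
      bounded by the same vertex sum.\<close>
    show "integrable \<nu> (\<lambda>y. 2 * ?W y)"
      using W by (rule integrable_mult_right)
    show "AE y in \<nu>. (\<lambda>n. ?s (n + N) y) \<longlonglongrightarrow> g y * (y \<bullet> v) * exp (y \<bullet> \<theta> + b y)"
    proof (rule AE_I2)
      fix y
      have "((\<lambda>t. g y * exp (y \<bullet> (\<theta> + t *\<^sub>R v) + b y)) has_real_derivative
          g y * (y \<bullet> v) * exp (y \<bullet> \<theta> + b y)) (at 0)"
        by (auto intro!: derivative_eq_intros simp: inner_add_right)
      then show "(\<lambda>n. ?s (n + N) y) \<longlonglongrightarrow> g y * (y \<bullet> v) * exp (y \<bullet> \<theta> + b y)"
        unfolding DERIV_def tendsto_at_iff_sequentially comp_def
        using hN LIMSEQ_ignore_initial_segment[OF h, of N] by force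
    qed
    show "AE y in \<nu>. norm (?s (n + N) y) \<le> 2 * ?W y" for n
    proof (rule AE_I2)
      fix y
      define k where "k = h (n + N)"
      have k: "k \<noteq> 0" using hN by (simp add: k_def)
      let ?T = "\<Sum>s\<in>S. exp (y \<bullet> s)"
      have le: "exp (y \<bullet> \<theta>) \<le> ?T" "exp (y \<bullet> (\<theta> + k *\<^sub>R v)) \<le> ?T"
        using N[of "n + N"] dS(1) by (auto intro!: dS(5) simp: dist_commute k_def)
      have "?s (n + N) y = g y * exp (y \<bullet> \<theta> + b y) * (exp (k * (y \<bullet> v)) - 1) / k"
        by (simp add: inner_add_right exp_add algebra_simps k_def)
      then have "norm (?s (n + N) y) = \<bar>g y\<bar> * exp (y \<bullet> \<theta> + b y) * \<bar>exp (k * (y \<bullet> v)) - 1\<bar> / \<bar>k\<bar>"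
        by (simp add: abs_mult)
      also have "\<dots> \<le> \<bar>g y\<bar> * exp (y \<bullet> \<theta> + b y) * (\<bar>k * (y \<bullet> v)\<bar> * (1 + exp (k * (y \<bullet> v)))) / \<bar>k\<bar>"
        by (intro divide_right_mono mult_left_mono abs_exp_minus_one_le) auto
      also have "\<dots> = \<bar>g y * (y \<bullet> v)\<bar> * exp (b y) * (exp (y \<bullet> \<theta>) + exp (y \<bullet> (\<theta> + k *\<^sub>R v)))"
        using k by (simp add: abs_mult exp_add inner_add_right divide_simps) (simp add: algebra_simps)
      also have "\<dots> \<le> \<bar>g y * (y \<bullet> v)\<bar> * exp (b y) * (?T + ?T)"
        using le by (intro mult_left_mono add_mono) auto
      finally show "norm (?s (n + N) y) \<le> 2 * ?W y"
        by (simp add: algebra_simps)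
    qed
  qed measurable
  moreover have "integral\<^sup>L \<nu> (?s (n + N)) =
      (tilted_moment g (\<theta> + (0 + h (n + N)) *\<^sub>R v) - tilted_moment g (\<theta> + 0 *\<^sub>R v)) / h (n + N)" for n
  proof -
    have "\<theta> + h (n + N) *\<^sub>R v \<in> U"
      using N[of "n + N"] dS(2) by (auto simp: dist_commute)
    then show ?thesis
      using g \<theta> by (simp add: tilted_moment_def admissible_def)
  qed
  ultimately have "(\<lambda>n. (tilted_moment g (\<theta> + (0 + h (n + N)) *\<^sub>R v) - tilted_moment g (\<theta> + 0 *\<^sub>R v)) / h (n + N))
      \<longlonglongrightarrow> tilted_moment (\<lambda>y. g y * (y \<bullet> v)) \<theta>"
    by (simp only:)
  then show "(\<lambda>n. (tilted_moment g (\<theta> + (0 + h n) *\<^sub>R v) - tilted_moment g (\<theta> + 0 *\<^sub>R v)) / h n)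
      \<longlonglongrightarrow> tilted_moment (\<lambda>y. g y * (y \<bullet> v)) \<theta>"
    by (rule LIMSEQ_offset)
qed

end

section \<open>Second-order expansions along lines\<close>

lemma has_real_derivative_line:
  fixes x v :: "'a::real_inner"
  assumes "GDERIV f (x + t *\<^sub>R v) :> D"
  shows "((\<lambda>s. f (x + s *\<^sub>R v)) has_real_derivative v \<bullet> D) (at t)"
proof -
  have "((\<lambda>s. x + s *\<^sub>R v) has_derivative (\<lambda>s. s *\<^sub>R v)) (at t)"
    by (auto intro!: derivative_eq_intros)
  from has_derivative_compose[OF this, of f "\<lambda>h. h \<bullet> D"] assms show ?thesis
    by (simp add: gderiv_def has_field_derivative_def mult_commute_abs)
qed

lemma has_real_derivative_line_gradient:
  fixes x v :: "real^'m"
  assumes "(f' has_derivative (\<lambda>h. H *v h)) (at (x + t *\<^sub>R v))"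
  shows "((\<lambda>s. w \<bullet> f' (x + s *\<^sub>R v)) has_real_derivative w \<bullet> (H *v v)) (at t)"
proof -
  have "((\<lambda>s. x + s *\<^sub>R v) has_derivative (\<lambda>s. s *\<^sub>R v)) (at t)"
    by (auto intro!: derivative_eq_intros)
  from has_derivative_compose[OF this, of f' "\<lambda>h. H *v h"] assms
  have "((\<lambda>s. f' (x + s *\<^sub>R v)) has_derivative (\<lambda>s. H *v (s *\<^sub>R v))) (at t)"
    by simp
  then have "((\<lambda>s. w \<bullet> f' (x + s *\<^sub>R v)) has_derivative (\<lambda>s. w \<bullet> (H *v (s *\<^sub>R v)))) (at t)"
    by (rule has_derivative_inner_right)
  then show ?thesis
    by (simp add: has_field_derivative_def matrix_vector_mult_scaleR mult_commute_abs)
qed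

lemma gradient_hessian_line_derivs:
  fixes x v :: "real^'m"
  assumes "gradient_hessian_on U f f' f''" "x + t *\<^sub>R v \<in> U"
  shows "((\<lambda>s. f (x + s *\<^sub>R v)) has_real_derivative v \<bullet> f' (x + t *\<^sub>R v)) (at t)"
    and "((\<lambda>s. w \<bullet> f' (x + s *\<^sub>R v)) has_real_derivative w \<bullet> (f'' (x + t *\<^sub>R v) *v v)) (at t)"
  using assms by (auto simp: gradient_hessian_on_def intro!: has_real_derivative_line has_real_derivative_line_gradient)

text \<open>Along the segment, \<open>f\<close> minus the parabola \<open>q * t\<^sup>2 / 2\<close>
  has nonnegative second derivative and hence stays above its tangent at \<open>t = 0\<close>; the
  claim is this at \<open>t = 1\<close>.\<close>

lemma gradient_hessian_taylor_lower:
  fixes x h :: "real^'m"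
  assumes gh: "gradient_hessian_on U f f' f''"
    and U: "\<And>t. t \<in> {0..1} \<Longrightarrow> x + t *\<^sub>R h \<in> U"
    and q: "\<And>t. t \<in> {0..1} \<Longrightarrow> q \<le> h \<bullet> (f'' (x + t *\<^sub>R h) *v h)"
  shows "h \<bullet> f' x + q / 2 \<le> f (x + h) - f x"
proof -
  have "(h \<bullet> f' (x + 0 *\<^sub>R h) - q * 0) * (1 - 0)
      \<le> (f (x + 1 *\<^sub>R h) - q * 1\<^sup>2 / 2) - (f (x + 0 *\<^sub>R h) - q * 0\<^sup>2 / 2)"
  proof (rule f''_imp_f'[of "{0..1}"])
    fix t :: real assume t: "t \<in> {0..1}"
    note d = gradient_hessian_line_derivs[OF gh U[OF t]]
    show "((\<lambda>t. f (x + t *\<^sub>R h) - q * t\<^sup>2 / 2) has_real_derivative h \<bullet> f' (x + t *\<^sub>R h) - q * t) (at t)"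
      using d(1) by (auto intro!: derivative_eq_intros)
    show "((\<lambda>t. h \<bullet> f' (x + t *\<^sub>R h) - q * t) has_real_derivative
        h \<bullet> (f'' (x + t *\<^sub>R h) *v h) - q) (at t)"
      using d(2) by (auto intro!: derivative_eq_intros)
    show "0 \<le> h \<bullet> (f'' (x + t *\<^sub>R h) *v h) - q"
      using q[OF t] by simp
  qed auto
  then show ?thesis
    by simp
qed

text \<open>The restriction to the segment is a function of one real variable with nonnegative
  second derivative; the claim is its chord inequality.\<close>

lemma gradient_hessian_convex_segment:
  fixes x h :: "real^'m"
  assumes gh: "gradient_hessian_on U f f' f''"
    and U: "\<And>t. t \<in> {0..1} \<Longrightarrow> x + t *\<^sub>R h \<in> U"
    and psd: "\<And>z. z \<in> U \<Longrightarrow> 0 \<le> h \<bullet> (f'' z *v h)"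
    and s: "s \<in> {0..1}"
  shows "f (x + s *\<^sub>R h) \<le> (1 - s) * f x + s * f (x + h)"
proof -
  have "convex_on {0..1} (\<lambda>t. f (x + t *\<^sub>R h))"
  proof (rule f''_ge0_imp_convex)
    fix t :: real assume t: "t \<in> {0..1}"
    show "((\<lambda>t. f (x + t *\<^sub>R h)) has_real_derivative h \<bullet> f' (x + t *\<^sub>R h)) (at t)"
      "((\<lambda>t. h \<bullet> f' (x + t *\<^sub>R h)) has_real_derivative h \<bullet> (f'' (x + t *\<^sub>R h) *v h)) (at t)"
      using gradient_hessian_line_derivs[OF gh U[OF t]] by auto
    show "0 \<le> h \<bullet> (f'' (x + t *\<^sub>R h) *v h)"
      using psd[OF U[OF t]] .
  qed auto
  from convex_onD[OF this, of s 0 1] s show ?thesis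
    by simp
qed

text \<open>Once the linear part at \<open>x\<close> is subtracted, the gradient at \<open>z\<close>
  is \<open>f' z - f' x\<close>. The mean value inequality bounds it by \<open>C * r\<close> on the
  ball, and a second application gives the Lipschitz bound. That the constant shrinks with
  \<open>r\<close> is what the sparsity argument exploits.\<close>

lemma gradient_hessian_bregman_lipschitz:
  fixes x :: "real^'m"
  assumes gh: "gradient_hessian_on U f f' f''"
    and U: "cball x r \<subseteq> U"
    and C: "\<And>z. z \<in> cball x r \<Longrightarrow> onorm (\<lambda>h. f'' z *v h) \<le> C"
    and h: "norm h1 \<le> r" "norm h2 \<le> r"
  shows "\<bar>(f (x + h1) - h1 \<bullet> f' x) - (f (x + h2) - h2 \<bullet> f' x)\<bar> \<le> C * r * norm (h1 - h2)"
proof -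
  have r: "r \<ge> 0"
    using order_trans[OF norm_ge_zero h(1)] .
  have C0: "C \<ge> 0"
  proof -
    have "x \<in> cball x r"
      using r by simp
    note C[OF this]
    moreover have "0 \<le> onorm (\<lambda>h. f'' x *v h)"
      by (rule onorm_pos_le) (rule matrix_vector_mul_bounded_linear)
    ultimately show ?thesis
      by linarith
  qed
  have f': "norm (f' z - f' x) \<le> C * r" if z: "z \<in> cball x r" for z
  proof -
    have "norm (f' z - f' x) \<le> C * norm (z - x)"
    proof (rule differentiable_bound[where S="cball x r" and f=f' and f'="\<lambda>y h. f'' y *v h"])
      show "(f' has_derivative (\<lambda>h. f'' y *v h)) (at y within cball x r)" if "y \<in> cball x r" for y
        using gh U that unfolding gradient_hessian_on_def by (blast intro: has_derivative_at_withinI[where s="cball x r"])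
      show "onorm (\<lambda>h. f'' y *v h) \<le> C" if "y \<in> cball x r" for y
        using that by (rule C)
      show "convex (cball x r)" "z \<in> cball x r" "x \<in> cball x r"
        using z r by simp_all
    qed
    also have "\<dots> \<le> C * r"
      using z C0 by (intro mult_left_mono) (auto simp: dist_norm norm_minus_commute)
    finally show ?thesis .
  qed
  let ?g = "\<lambda>z. f z - (z - x) \<bullet> f' x"
  have "norm (?g (x + h1) - ?g (x + h2)) \<le> C * r * norm ((x + h1) - (x + h2))"
  proof (rule differentiable_bound[where S="cball x r" and f="?g" and f'="\<lambda>z h. h \<bullet> (f' z - f' x)"])
    fix z assume z: "z \<in> cball x r"
    have "(f has_derivative (\<lambda>h. h \<bullet> f' z)) (at z)"
      using gh z U by (auto simp: gradient_hessian_on_def gderiv_def)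
    then have "(?g has_derivative (\<lambda>h. h \<bullet> (f' z - f' x))) (at z)"
      by (auto intro!: derivative_eq_intros simp: inner_diff_right)
    then show "(?g has_derivative (\<lambda>h. h \<bullet> (f' z - f' x))) (at z within cball x r)"
      by (rule has_derivative_at_withinI)
  next
    fix z assume z: "z \<in> cball x r"
    show "onorm (\<lambda>h. h \<bullet> (f' z - f' x)) \<le> C * r"
    proof (rule onorm_bound)
      show "norm (h \<bullet> (f' z - f' x)) \<le> C * r * norm h" for h
        using Cauchy_Schwarz_ineq2[of h "f' z - f' x"] mult_left_mono[OF f'[OF z], of "norm h"]
        by (simp add: mult.commute)
    qed (use C0 r in simp)
  next
    show "convex (cball x r)" "x + h1 \<in> cball x r" "x + h2 \<in> cball x r"
      using h by (simp_all add: dist_norm)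
  qed
  then show ?thesis
    by simp
qed

section \<open>Mean and covariance of a natural exponential family\<close>

text \<open>Here \<open>a'\<close> and \<open>a''\<close> are known only as derivatives of the
  log-partition function; their meaning as mean and covariance is derived below.\<close>

locale natural_exponential_family =
  fixes \<nu> :: "(real^'r) measure" and b :: "real^'r \<Rightarrow> real"
    and a' :: "real^'r \<Rightarrow> real^'r" and a'' :: "real^'r \<Rightarrow> real^'r^'r"
  assumes sets_base': "sets \<nu> = sets borel"
    and b_measurable': "b \<in> borel_measurable borel"
    and derivs: "gradient_hessian_on (interior (natural_parameter_space \<nu> b)) (log_partition \<nu> b) a' a''"
begin

abbreviation \<Theta> :: "(real^'r) set" where "\<Theta> \<equiv> interior (natural_parameter_space \<nu> b)"

sublocale exp_tilt \<nu> b \<Theta>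
proof
  note [measurable_cong] = sets_base' and [measurable] = b_measurable'
  fix \<theta> assume "\<theta> \<in> \<Theta>"
  then have "\<theta> \<in> natural_parameter_space \<nu> b"
    using interior_subset by blast
  then show "integrable \<nu> (\<lambda>y. exp (y \<bullet> \<theta> + b y))"
    by (intro integrableI_bounded) (auto simp: natural_parameter_space_def)
qed (use sets_base' b_measurable' in auto)

abbreviation Z :: "real^'r \<Rightarrow> real" where "Z \<equiv> tilted_moment (\<lambda>_. 1)"

lemma Z_pos: "\<theta> \<in> \<Theta> \<Longrightarrow> 0 < Z \<theta>"
proof -
  assume \<theta>: "\<theta> \<in> \<Theta>"
  then have "\<theta> \<in> natural_parameter_space \<nu> b"
    using interior_subset by blast
  moreover have "(\<integral>\<^sup>+ y. ennreal (exp (y \<bullet> \<theta> + b y)) \<partial>\<nu>) = ennreal (Z \<theta>)"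
    using integrable_exp[OF \<theta>] by (subst nn_integral_eq_integral) (auto simp: tilted_moment_def)
  ultimately show ?thesis
    by (auto simp: natural_parameter_space_def)
qed

lemma log_partition_eq: "log_partition \<nu> b \<theta> = ln (Z \<theta>)"
  by (simp add: log_partition_def tilted_moment_def)

lemma nef_density_eq:
  "\<theta> \<in> \<Theta> \<Longrightarrow> nef_density \<nu> b \<theta> y = exp (y \<bullet> \<theta> + b y) / Z \<theta>"
  using Z_pos[of \<theta>] by (simp add: nef_density_def log_partition_eq exp_add exp_diff)

text \<open>The directional derivative of \<open>ln (Z \<theta>)\<close> is computed twice, from the
  given gradient and under the integral sign; derivatives are unique.\<close>

lemma mean_eq:
  assumes \<theta>: "\<theta> \<in> \<Theta>"
  shows "v \<bullet> a' \<theta> = tilted_moment (\<lambda>y. y \<bullet> v) \<theta> / Z \<theta>"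
proof -
  have "((\<lambda>t. log_partition \<nu> b (\<theta> + t *\<^sub>R v)) has_real_derivative v \<bullet> a' \<theta>) (at 0)"
    using gradient_hessian_line_derivs(1)[OF derivs, of \<theta> 0 v] \<theta> by simp
  moreover have "((\<lambda>t. log_partition \<nu> b (\<theta> + t *\<^sub>R v)) has_real_derivative
      tilted_moment (\<lambda>y. y \<bullet> v) \<theta> / Z \<theta>) (at 0)"
    using has_real_derivative_tilted_moment[OF admissible_const[of 1] \<theta>, of v] Z_pos[OF \<theta>]
    unfolding log_partition_eq by (auto intro!: derivative_eq_intros)
  ultimately show ?thesis
    by (rule DERIV_unique)
qed

text \<open>The mean formula holds in a neighbourhood of \<theta>, so the quotient in it can be
  differentiated once more and compared with the given Hessian. The quotient rule then yields the
  covariance of \<open>y \<bullet> w\<close> and \<open>y \<bullet> v\<close>.\<close>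

lemma covariance_eq:
  assumes \<theta>: "\<theta> \<in> \<Theta>"
  shows "w \<bullet> (a'' \<theta> *v v) = tilted_moment (\<lambda>y. (y \<bullet> w) * (y \<bullet> v)) \<theta> / Z \<theta>
    - (w \<bullet> a' \<theta>) * (v \<bullet> a' \<theta>)"
proof -
  let ?m = "\<lambda>t. tilted_moment (\<lambda>y. y \<bullet> w) (\<theta> + t *\<^sub>R v)"
  let ?z = "\<lambda>t. Z (\<theta> + t *\<^sub>R v)"
  have "((\<lambda>t. w \<bullet> a' (\<theta> + t *\<^sub>R v)) has_real_derivative w \<bullet> (a'' \<theta> *v v)) (at 0)"
    using gradient_hessian_line_derivs(2)[OF derivs, of \<theta> 0 v] \<theta> by simp
  moreover have "eventually (\<lambda>t. \<theta> + t *\<^sub>R v \<in> \<Theta>) (at 0)"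
  proof -
    have "((\<lambda>t. \<theta> + t *\<^sub>R v) \<longlongrightarrow> \<theta> + 0 *\<^sub>R v) (at 0)"
      by (intro tendsto_intros)
    from topological_tendstoD[OF this open_U] \<theta> show ?thesis
      by simp
  qed
  then have "eventually (\<lambda>t. w \<bullet> a' (\<theta> + t *\<^sub>R v) = ?m t / ?z t) (nhds 0)"
    unfolding eventually_at_filter
  proof (rule eventually_mono)
    fix t assume "t \<noteq> 0 \<longrightarrow> t \<in> UNIV \<longrightarrow> \<theta> + t *\<^sub>R v \<in> \<Theta>"
    then have "\<theta> + t *\<^sub>R v \<in> \<Theta>"
      using \<theta> by (cases "t = 0") auto
    then show "w \<bullet> a' (\<theta> + t *\<^sub>R v) = ?m t / ?z t"
      by (rule mean_eq)
  qed
  ultimately have "((\<lambda>t. ?m t / ?z t) has_real_derivative w \<bullet> (a'' \<theta> *v v)) (at 0)"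
    by (subst (asm) DERIV_cong_ev) auto
  moreover have "((\<lambda>t. ?m t / ?z t) has_real_derivative
     (tilted_moment (\<lambda>y. (y \<bullet> w) * (y \<bullet> v)) \<theta> * Z \<theta>
      - tilted_moment (\<lambda>y. y \<bullet> w) \<theta> * tilted_moment (\<lambda>y. y \<bullet> v) \<theta>) / (Z \<theta> * Z \<theta>)) (at 0)"
    using has_real_derivative_tilted_moment[OF admissible_const[of 1] \<theta>, of v]
      has_real_derivative_tilted_moment[OF admissible_inner[of w] \<theta>, of v] Z_pos[OF \<theta>]
    by (auto intro!: derivative_eq_intros)
  ultimately have "w \<bullet> (a'' \<theta> *v v) = (tilted_moment (\<lambda>y. (y \<bullet> w) * (y \<bullet> v)) \<theta> * Z \<theta>
      - tilted_moment (\<lambda>y. y \<bullet> w) \<theta> * tilted_moment (\<lambda>y. y \<bullet> v) \<theta>) / (Z \<theta> * Z \<theta>)"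
    by (rule DERIV_unique)
  then show ?thesis
    using Z_pos[OF \<theta>] unfolding mean_eq[OF \<theta>] by (simp add: diff_divide_distrib)
qed

text \<open>Each entry of \<open>a''\<close> is its bilinear form at two unit vectors, hence by the
  covariance formula a rational expression in moments that are continuous by dominated
  convergence.\<close>

lemma continuous_on_hessian: "continuous_on \<Theta> a''"
proof -
  have entry: "a'' \<theta> $ i $ j = axis i 1 \<bullet> (a'' \<theta> *v axis j 1)" for \<theta> i j
    by (simp add: inner_axis' matrix_vector_mul_component inner_axis)
  have "continuous_on \<Theta> (\<lambda>\<theta>. w \<bullet> (a'' \<theta> *v v))" for w v
  proof (rule continuous_on_cong[THEN iffD1, OF refl])
    show "continuous_on \<Theta> (\<lambda>\<theta>. tilted_moment (\<lambda>y. (y \<bullet> w) * (y \<bullet> v)) \<theta> / Z \<theta>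
       - (tilted_moment (\<lambda>y. y \<bullet> w) \<theta> / Z \<theta>) * (tilted_moment (\<lambda>y. y \<bullet> v) \<theta> / Z \<theta>))"
    proof (intro continuous_intros continuous_on_tilted_moment admissible_const admissible_inner
          admissible_mult_inner)
    qed (auto dest: Z_pos)
  qed (simp add: covariance_eq mean_eq)
  then have "continuous_on \<Theta> (\<lambda>\<theta>. \<chi> i. \<chi> j. a'' \<theta> $ i $ j)"
    unfolding entry by (intro continuous_on_vec_lambda)
  then show ?thesis
    by simp
qed

lemma integral_nef_density:
  assumes \<theta>: "\<theta> \<in> \<Theta>" and g: "admissible g"
  shows "integrable \<nu> (\<lambda>y. nef_density \<nu> b \<theta> y * g y)"
    and "(\<integral>y. nef_density \<nu> b \<theta> y * g y \<partial>\<nu>) = tilted_moment g \<theta> / Z \<theta>"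
proof -
  have eq: "nef_density \<nu> b \<theta> y * g y = (g y * exp (y \<bullet> \<theta> + b y)) / Z \<theta>" for y
    using nef_density_eq[OF \<theta>] by simp
  show "integrable \<nu> (\<lambda>y. nef_density \<nu> b \<theta> y * g y)"
    unfolding eq using g \<theta> by (auto simp: admissible_def)
  show "(\<integral>y. nef_density \<nu> b \<theta> y * g y \<partial>\<nu>) = tilted_moment g \<theta> / Z \<theta>"
    unfolding eq by (simp add: tilted_moment_def)
qed

text \<open>Expectations of admissible functions of \<open>Y\<close> are quotients of tilted
  moments, so the formulas for \<open>a'\<close> and \<open>a''\<close> give mean and variance of
  every projection of \<open>Y\<close>.\<close>

lemma
  assumes dist: "distributed M \<nu> Y (\<lambda>y. ennreal (nef_density \<nu> b \<theta> y))"
    and M: "prob_space M" and \<theta>: "\<theta> \<in> \<Theta>"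
  shows nef_mean: "(\<integral>x. Y x \<bullet> v - v \<bullet> a' \<theta> \<partial>M) = 0"
    and nef_square_integrable: "integrable M (\<lambda>x. (Y x \<bullet> v - v \<bullet> a' \<theta>)\<^sup>2)"
    and nef_variance: "(\<integral>x. (Y x \<bullet> v - v \<bullet> a' \<theta>)\<^sup>2 \<partial>M) = v \<bullet> (a'' \<theta> *v v)"
proof -
  interpret prob_space M by fact
  have pos: "0 \<le> nef_density \<nu> b \<theta> y" for y
    by (simp add: nef_density_def)
  have 1: "integrable M (\<lambda>x. g (Y x))" "(\<integral>x. g (Y x) \<partial>M) = tilted_moment g \<theta> / Z \<theta>"
    if g: "admissible g" for g
  proof -
    have [measurable]: "g \<in> borel_measurable \<nu>"
      using g by (simp add: admissible_def measurable_cong_sets[OF sets_base refl])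
    show "integrable M (\<lambda>x. g (Y x))"
      using distributed_integrable[OF dist, of g] pos integral_nef_density[OF \<theta> g] by simp
    show "(\<integral>x. g (Y x) \<partial>M) = tilted_moment g \<theta> / Z \<theta>"
      using distributed_integral[OF dist, of g] pos integral_nef_density[OF \<theta> g] by simp
  qed
  let ?m = "v \<bullet> a' \<theta>"
  note i1 = 1[OF admissible_inner[of v]] and i2 = 1[OF admissible_mult_inner[OF admissible_inner[of v], of v]]
  have eq: "(Y x \<bullet> v - ?m)\<^sup>2 = (Y x \<bullet> v) * (Y x \<bullet> v) - (2 * ?m) * (Y x \<bullet> v) + ?m\<^sup>2" for x
    by (simp add: power2_eq_square algebra_simps)
  show "(\<integral>x. Y x \<bullet> v - ?m \<partial>M) = 0"
    using i1 mean_eq[OF \<theta>, of v] by (simp add: prob_space)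
  show "integrable M (\<lambda>x. (Y x \<bullet> v - ?m)\<^sup>2)"
    unfolding eq using i1 i2 by simp
  have "(\<integral>x. (Y x \<bullet> v - ?m)\<^sup>2 \<partial>M) =
      tilted_moment (\<lambda>y. (y \<bullet> v) * (y \<bullet> v)) \<theta> / Z \<theta> - 2 * ?m * (tilted_moment (\<lambda>y. y \<bullet> v) \<theta> / Z \<theta>) + ?m\<^sup>2"
    unfolding eq using i1 i2 by (simp add: prob_space)
  then show "(\<integral>x. (Y x \<bullet> v - ?m)\<^sup>2 \<partial>M) = v \<bullet> (a'' \<theta> *v v)"
    unfolding covariance_eq[OF \<theta>] mean_eq[OF \<theta>, of v, symmetric] by (simp add: power2_eq_square)
qed

end

section \<open>Sparsity of penalized minimizers\<close>

text \<open>If the penalty is steeper near zero than the Lipschitz constant of \<open>L\<close>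
  near the minimizer, then replacing the components that should vanish by zero strictly decreases the objective.\<close>

lemma penalized_minimizer_sparse:
  fixes L :: "real^'p \<Rightarrow> real" and pen :: "real \<Rightarrow> real" and \<beta>s :: "real^'p"
    and \<rho> N l c \<kappa> C h \<delta> :: real
  assumes ball: "cball \<beta>s \<rho> \<subseteq> B" and \<rho>: "\<rho> > 0"
    and pos: "N > 0" "l > 0" "c > 0" "\<kappa> \<ge> 0" "C \<ge> 0"
    and cont: "continuous_on (cball \<beta>s \<rho>) L"
    and radial: "\<And>\<beta> s. \<beta> \<in> B \<Longrightarrow> s \<in> {0..1} \<Longrightarrow>
        L (\<beta>s + s *\<^sub>R (\<beta> - \<beta>s)) \<le> (1 - s) * L \<beta>s + s * L \<beta>"
    and lower: "\<And>\<beta>. \<beta> \<in> cball \<beta>s \<rho> \<Longrightarrow>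
        c * N * (norm (\<beta> - \<beta>s))\<^sup>2 - \<kappa> * N * l * norm (\<beta> - \<beta>s) \<le> L \<beta> - L \<beta>s"
    and lip: "\<And>\<beta> z r. r \<le> \<rho> \<Longrightarrow> \<beta> \<in> cball \<beta>s r \<Longrightarrow> z \<in> cball \<beta>s r \<Longrightarrow>
        \<bar>L \<beta> - L z\<bar> \<le> (\<kappa> * N * l + C * N * r) * norm (\<beta> - z)"
    and pen_cont: "continuous_on UNIV pen" and pen_0: "pen 0 = 0"
    and pen_nonneg: "\<And>x. 0 \<le> pen x" and pen_le: "\<And>x. pen x \<le> h"
    and pen_flat: "\<And>j x. \<beta>s $ j \<noteq> 0 \<Longrightarrow> \<bar>x - \<beta>s $ j\<bar> \<le> \<rho> \<Longrightarrow> pen x = pen (\<beta>s $ j)"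
    and pen_slope: "\<And>x. 0 < \<bar>x\<bar> \<Longrightarrow> \<bar>x\<bar> \<le> \<delta> * l \<Longrightarrow> l / 2 * \<bar>x\<bar> \<le> pen x"
    and num: "real CARD('p) * h < c * \<rho>\<^sup>2 - \<kappa> * l * \<rho>" "\<kappa> \<le> c * \<delta>" "\<kappa> * (1 + C / c) < 1 / 2"
  defines "Q \<equiv> \<lambda>\<beta>. L \<beta> + N * (\<Sum>j\<in>UNIV. pen (\<beta> $ j))"
  shows "\<exists>\<beta>. is_arg_min Q (\<lambda>\<beta>. \<beta> \<in> B) \<beta>"
    and "\<And>\<beta> j. is_arg_min Q (\<lambda>\<beta>. \<beta> \<in> B) \<beta> \<Longrightarrow> \<beta>s $ j = 0 \<Longrightarrow> \<beta> $ j = 0"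
proof -
  have \<beta>s_B: "\<beta>s \<in> B"
    using ball \<rho> by auto
  \<comment> \<open>On the ray from \<open>\<beta>s\<close> to \<beta>, the point \<open>?z\<close>
    at distance \<rho> already has a loss excess above \<open>N\<close> times the largest possible
    total penalty. By convexity along the ray the excess at \<beta> is at least as large, so the
    penalty at \<open>\<beta>s\<close> cannot compensate for it.\<close>
  have outside: "Q \<beta>s < Q \<beta>" if \<beta>: "\<beta> \<in> B" "norm (\<beta> - \<beta>s) \<ge> \<rho>" for \<beta>
  proof -
    define s where "s = \<rho> / norm (\<beta> - \<beta>s)"
    have n0: "norm (\<beta> - \<beta>s) > 0"
      using \<beta> \<rho> by linarith
    have s: "0 < s" "s \<le> 1"
      using \<beta> \<rho> n0 by (auto simp: s_def)
    let ?z = "\<beta>s + s *\<^sub>R (\<beta> - \<beta>s)"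
    have z: "norm (?z - \<beta>s) = \<rho>"
      using n0 \<rho> by (simp add: s_def)
    have "real CARD('p) * h * N < (c * \<rho>\<^sup>2 - \<kappa> * l * \<rho>) * N"
      using num(1) pos(1) by simp
    also have "\<dots> = c * N * \<rho>\<^sup>2 - \<kappa> * N * l * \<rho>"
      by (simp add: algebra_simps)
    also have "\<dots> \<le> L ?z - L \<beta>s"
      using lower[of ?z] z \<rho> by (simp add: dist_norm)
    also have "\<dots> \<le> s * (L \<beta> - L \<beta>s)"
      using radial[OF \<beta>(1), of s] s by (simp add: algebra_simps)
    finally have gt: "real CARD('p) * h * N < s * (L \<beta> - L \<beta>s)" .
    have "0 \<le> h"
      using pen_nonneg[of 0] pen_le[of 0] by linarith
    then have "0 \<le> real CARD('p) * h * N"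
      using pos by simp
    then have "0 < s * (L \<beta> - L \<beta>s)"
      using gt by linarith
    then have "0 < L \<beta> - L \<beta>s"
      using s by (simp add: zero_less_mult_iff)
    then have "s * (L \<beta> - L \<beta>s) \<le> L \<beta> - L \<beta>s"
      using s by (intro mult_left_le_one_le) auto
    with gt have 1: "real CARD('p) * h * N < L \<beta> - L \<beta>s"
      by (rule less_le_trans)
    have "(\<Sum>j\<in>UNIV. pen (\<beta>s $ j)) \<le> (\<Sum>j\<in>(UNIV :: 'p set). h)"
      by (intro sum_mono pen_le)
    then have "N * (\<Sum>j\<in>UNIV. pen (\<beta>s $ j)) \<le> N * (real CARD('p) * h)"
      using pos by (intro mult_left_mono) auto
    moreover have "0 \<le> N * (\<Sum>j\<in>UNIV. pen (\<beta> $ j))"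
      using pos by (intro mult_nonneg_nonneg sum_nonneg pen_nonneg) auto
    ultimately show ?thesis
      using 1 unfolding Q_def by (simp add: algebra_simps)
  qed
  \<comment> \<open>The minimum over the compact ball is global, because every point of
    \<open>B\<close> outside the ball is beaten by the centre.\<close>
  show "\<exists>\<beta>. is_arg_min Q (\<lambda>\<beta>. \<beta> \<in> B) \<beta>"
  proof -
    have comp: "continuous_on (cball \<beta>s \<rho>) (\<lambda>\<beta>. pen (\<beta> $ j))" for j
      by (rule continuous_on_compose2[OF pen_cont]) (auto intro!: continuous_intros)
    have "continuous_on (cball \<beta>s \<rho>) Q"
      unfolding Q_def by (intro continuous_intros cont comp)
    moreover have "cball \<beta>s \<rho> \<noteq> {}"
      using \<rho> by simp
    ultimately obtain x where x: "x \<in> cball \<beta>s \<rho>" "\<And>y. y \<in> cball \<beta>s \<rho> \<Longrightarrow> Q x \<le> Q y"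
      using continuous_attains_inf[OF compact_cball, of \<beta>s \<rho> Q] by blast
    have "Q x \<le> Q y" if "y \<in> B" for y
    proof (cases "y \<in> cball \<beta>s \<rho>")
      case False
      then have "Q \<beta>s < Q y"
        using that by (intro outside) (auto simp: dist_norm norm_minus_commute)
      moreover have "Q x \<le> Q \<beta>s"
        using \<rho> by (intro x) auto
      ultimately show ?thesis by linarith
    qed (use x in auto)
    then show ?thesis
      using x ball unfolding is_arg_min_linorder by blast
  qed
  fix \<beta> :: "real^'p" and j :: 'p
  assume am: "is_arg_min Q (\<lambda>\<beta>. \<beta> \<in> B) \<beta>" and "\<beta>s $ j = 0"
  then have \<beta>: "\<beta> \<in> B" and min: "\<And>y. y \<in> B \<Longrightarrow> Q \<beta> \<le> Q y"
    by (auto simp: is_arg_min_linorder)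
  define d where "d = norm (\<beta> - \<beta>s)"
  have d: "d < \<rho>" "0 \<le> d"
    using outside[OF \<beta>] min[OF \<beta>s_B] by (auto simp: d_def not_le[symmetric])
  then have \<beta>_ball: "\<beta> \<in> cball \<beta>s \<rho>"
    by (simp add: dist_norm norm_minus_commute d_def)
  have comp_le: "\<bar>\<beta> $ j - \<beta>s $ j\<bar> \<le> d" for j
    using component_le_norm_cart[of "\<beta> - \<beta>s" j] by (simp add: d_def)
  have flat: "pen (\<beta> $ j) = pen (\<beta>s $ j)" if "\<beta>s $ j \<noteq> 0" for j
    using comp_le[of j] d by (intro pen_flat that) auto

  \<comment> \<open>Passing from \<open>\<beta>s\<close> to \<beta> cannot lower the penalty: it is
    constant near the nonzero components and starts from 0 at the others. Minimality therefore
    forces \<open>L \<beta> \<le> L \<beta>s\<close>, and the quadratic lower bound limits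
    \<open>d\<close>.\<close>
  have "(\<Sum>j\<in>UNIV. pen (\<beta>s $ j)) \<le> (\<Sum>j\<in>UNIV. pen (\<beta> $ j))"
  proof (rule sum_mono)
    show "pen (\<beta>s $ j) \<le> pen (\<beta> $ j)" for j
      using flat[of j] pen_0 pen_nonneg by (cases "\<beta>s $ j = 0") auto
  qed
  then have "N * (\<Sum>j\<in>UNIV. pen (\<beta>s $ j)) \<le> N * (\<Sum>j\<in>UNIV. pen (\<beta> $ j))"
    using pos by simp
  then have "L \<beta> \<le> L \<beta>s"
    using min[OF \<beta>s_B] by (simp add: Q_def)
  then have "c * N * d\<^sup>2 \<le> \<kappa> * N * l * d"
    using lower[OF \<beta>_ball] by (simp add: d_def)
  then have "N * d * (c * d) \<le> N * d * (\<kappa> * l)"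
    by (simp add: power2_eq_square algebra_simps)
  then have "c * d \<le> \<kappa> * l"
    using pos d(2) by (cases "d = 0") (auto simp: mult_le_cancel_left_pos)
  then have d_le: "d \<le> \<kappa> * l / c"
    using pos by (simp add: field_simps)
  \<comment> \<open>The choice \<open>\<kappa> \<le> c * \<delta>\<close> brings the minimizer into
    the range where the penalty has slope at least \<open>l / 2\<close>.\<close>
  also have "\<dots> \<le> c * \<delta> * l / c"
    using num pos by (intro divide_right_mono mult_right_mono) auto
  finally have d\<delta>: "d \<le> \<delta> * l"
    using pos by simp

  \<comment> \<open>The competitor: no farther from \<open>\<beta>s\<close> than \<beta>, so it
    stays in the same ball and in \<open>B\<close>.\<close>
  define z where "z = (\<chi> j. if \<beta>s $ j = 0 then 0 else \<beta> $ j)"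
  have z_j: "z $ j = (if \<beta>s $ j = 0 then 0 else \<beta> $ j)" for j
    by (simp add: z_def)
  have "norm (z - \<beta>s) \<le> d"
    unfolding d_def by (intro norm_le_componentwise_cart) (auto simp: z_j)
  then have z_ball: "z \<in> cball \<beta>s d" and zB: "z \<in> B"
    using d ball by (auto simp: dist_norm norm_minus_commute intro!: subsetD[OF ball])
  let ?D = "\<Sum>j\<in>UNIV. \<bar>(\<beta> - z) $ j\<bar>"
  have "l / 2 * \<bar>(\<beta> - z) $ j\<bar> \<le> pen (\<beta> $ j) - pen (z $ j)" for j
  proof (cases "\<beta>s $ j = 0 \<and> \<beta> $ j \<noteq> 0")
    case True
    then show ?thesis
      using pen_slope[of "\<beta> $ j"] comp_le[of j] d\<delta> pen_0 by (auto simp: z_j)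
  qed (use pen_0 in \<open>auto simp: z_j\<close>)
  then have "(\<Sum>j\<in>UNIV. l / 2 * \<bar>(\<beta> - z) $ j\<bar>) \<le> (\<Sum>j\<in>UNIV. pen (\<beta> $ j) - pen (z $ j))"
    by (intro sum_mono)
  then have "l / 2 * ?D \<le> (\<Sum>j\<in>UNIV. pen (\<beta> $ j)) - (\<Sum>j\<in>UNIV. pen (z $ j))"
    by (simp add: sum_subtractf sum_distrib_left)
  then have "N * (l / 2 * ?D) \<le> N * ((\<Sum>j\<in>UNIV. pen (\<beta> $ j)) - (\<Sum>j\<in>UNIV. pen (z $ j)))"
    using pos by (intro mult_left_mono) auto
  also have "\<dots> \<le> \<bar>L \<beta> - L z\<bar>"
    using min[OF zB] by (simp add: Q_def algebra_simps)
  \<comment> \<open>The Lipschitz bound is taken at radius \<open>d\<close> instead of \<rho>. As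
    \<open>d \<le> \<kappa> * l / c\<close>, both of its terms are then proportional to
    \<kappa>.\<close>
  also have "\<dots> \<le> (\<kappa> * N * l + C * N * d) * norm (\<beta> - z)"
    using z_ball d by (intro lip) (auto simp: d_def dist_norm norm_minus_commute)
  also have "\<dots> \<le> (\<kappa> * N * l + C * N * (\<kappa> * l / c)) * norm (\<beta> - z)"
    using pos d_le by (intro mult_right_mono add_left_mono mult_left_mono) auto
  also have "\<dots> = N * l * (\<kappa> * (1 + C / c)) * norm (\<beta> - z)"
    by (simp add: algebra_simps)
  finally have 1: "N * l * (1 / 2) * ?D \<le> N * l * (\<kappa> * (1 + C / c)) * norm (\<beta> - z)"
    by (simp add: algebra_simps)
  \<comment> \<open>Replacing the Euclidean norm by the l1 norm makes both sides multiples of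
    \<open>?D\<close>; since \<open>\<kappa> * (1 + C / c) < 1 / 2\<close>, it follows that
    \<open>?D = 0\<close>.\<close>
  have "N * l * (\<kappa> * (1 + C / c)) * norm (\<beta> - z) \<le> N * l * (\<kappa> * (1 + C / c)) * ?D"
    using pos norm_le_l1_cart[of "\<beta> - z"] by (intro mult_left_mono) auto
  with 1 have "N * l * (1 / 2) * ?D \<le> N * l * (\<kappa> * (1 + C / c)) * ?D"
    by linarith
  then have "N * l * (?D * (1 / 2 - \<kappa> * (1 + C / c))) \<le> 0"
    by (simp add: algebra_simps)
  then have "?D * (1 / 2 - \<kappa> * (1 + C / c)) \<le> 0"
    using pos by (simp add: mult_le_0_iff)
  then have "?D \<le> 0"
    using num(3) by (simp add: mult_le_0_iff)
  then have "?D = 0"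
    by (intro antisym sum_nonneg) auto
  then have "(\<beta> - z) $ j = 0"
    by (simp add: sum_nonneg_eq_0_iff)
  then show "\<beta> $ j = 0"
    using \<open>\<beta>s $ j = 0\<close> by (simp add: z_j)
qed

section \<open>A tail bound for sums of independent variables\<close>

text \<open>Induction on \<open>n\<close>: the new term is independent of the partial sum and both
  are centred, so the cross term has expectation 0.\<close>

lemma (in prob_space) indep_sum_second_moment:
  fixes \<xi> :: "nat \<Rightarrow> 'a \<Rightarrow> real"
  assumes indep: "indep_vars (\<lambda>_. borel) \<xi> UNIV"
    and sq: "\<And>i. integrable M (\<lambda>x. (\<xi> i x)\<^sup>2)"
    and mean: "\<And>i. expectation (\<xi> i) = 0"
    and var: "\<And>i. expectation (\<lambda>x. (\<xi> i x)\<^sup>2) \<le> V"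
  shows "integrable M (\<lambda>x. (\<Sum>i<n. \<xi> i x)\<^sup>2)"
    and "expectation (\<lambda>x. (\<Sum>i<n. \<xi> i x)\<^sup>2) \<le> real n * V"
proof -
  have rv [measurable]: "\<xi> i \<in> borel_measurable M" for i
    using indep by (auto simp: indep_vars_def)
  have int: "integrable M (\<xi> i)" for i
    using square_integrable_imp_integrable[OF rv sq] .
  have "integrable M (\<lambda>x. (\<Sum>i<n. \<xi> i x)\<^sup>2) \<and> expectation (\<lambda>x. (\<Sum>i<n. \<xi> i x)\<^sup>2) \<le> real n * V"
  proof (induction n)
    case (Suc n)
    let ?S = "\<lambda>x. \<Sum>i<n. \<xi> i x"
    have iv: "indep_var borel (\<xi> n) borel ?S"
      by (rule indep_vars_sum) (auto intro: indep_vars_subset[OF indep])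
    have S: "integrable M ?S"
      using int by simp
    have cross: "integrable M (\<lambda>x. \<xi> n x * ?S x)" "expectation (\<lambda>x. \<xi> n x * ?S x) = 0"
      using indep_var_integrable[OF iv int S] indep_var_lebesgue_integral[OF iv int S] mean by auto
    have eq: "(\<Sum>i<Suc n. \<xi> i x)\<^sup>2 = (?S x)\<^sup>2 + (\<xi> n x)\<^sup>2 + 2 * (\<xi> n x * ?S x)" for x
      by (simp add: power2_eq_square algebra_simps)
    show ?case
      unfolding eq using Suc sq[of n] cross var[of n] by (simp add: algebra_simps)
  qed simp
  then show "integrable M (\<lambda>x. (\<Sum>i<n. \<xi> i x)\<^sup>2)"
    "expectation (\<lambda>x. (\<Sum>i<n. \<xi> i x)\<^sup>2) \<le> real n * V" by auto
qed

lemma (in prob_space) indep_sum_tail: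
  fixes \<xi> :: "nat \<Rightarrow> 'a \<Rightarrow> real"
  assumes indep: "indep_vars (\<lambda>_. borel) \<xi> UNIV"
    and sq: "\<And>i. integrable M (\<lambda>x. (\<xi> i x)\<^sup>2)"
    and mean: "\<And>i. expectation (\<xi> i) = 0"
    and var: "\<And>i. expectation (\<lambda>x. (\<xi> i x)\<^sup>2) \<le> V"
    and t: "t > 0"
  shows "prob {x \<in> space M. t \<le> \<bar>\<Sum>i<n. \<xi> i x\<bar>} \<le> real n * V / t\<^sup>2"
proof -
  note S = indep_sum_second_moment[OF indep sq mean var, of n]
  have [measurable]: "\<xi> i \<in> borel_measurable M" for i
    using indep by (auto simp: indep_vars_def)
  have "prob {x \<in> space M. t \<le> \<bar>\<Sum>i<n. \<xi> i x\<bar>} \<le> expectation (\<lambda>x. (\<Sum>i<n. \<xi> i x)\<^sup>2) / t\<^sup>2"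
    using second_moment_method[OF _ S(1) t] by simp
  also have "\<dots> \<le> real n * V / t\<^sup>2"
    using S(2) by (intro divide_right_mono) auto
  finally show ?thesis .
qed

section \<open>Uniform quadratic bounds for the Bregman divergence\<close>

text \<open>Here \<open>norm A\<close> is the Frobenius norm, and Cauchy-Schwarz is applied row by
  row.\<close>

lemma norm_matrix_vector_mult_le: "norm (A *v v) \<le> norm A * norm v"
  for A :: "real^'n^'m"
proof -
  have "norm (A *v v) = L2_set (\<lambda>i. \<bar>A $ i \<bullet> v\<bar>) UNIV"
    by (simp add: norm_vec_def[of "A *v v"] matrix_vector_mul_component)
  also have "\<dots> \<le> L2_set (\<lambda>i. norm (A $ i) * norm v) UNIV"
    by (intro L2_set_mono Cauchy_Schwarz_ineq2) auto
  also have "\<dots> = norm A * norm v"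
    by (simp add: L2_set_left_distrib[symmetric] norm_vec_def[of A])
  finally show ?thesis .
qed

lemma abs_quadratic_form_le: "\<bar>v \<bullet> (A *v v)\<bar> \<le> norm A * (norm v)\<^sup>2"
  for A :: "real^'n^'n"
proof -
  have "\<bar>v \<bullet> (A *v v)\<bar> \<le> norm v * norm (A *v v)"
    by (rule Cauchy_Schwarz_ineq2)
  also have "\<dots> \<le> norm v * (norm A * norm v)"
    by (intro mult_left_mono norm_matrix_vector_mult_le) auto
  finally show ?thesis
    by (simp add: power2_eq_square mult_ac)
qed

text \<open>The constant is the minimum of the quadratic form over the unit sphere, attained by
  compactness and therefore positive; homogeneity extends the bound to all vectors.\<close>

lemma positive_definite_lower_bound:
  fixes A :: "real^'n^'n"
  assumes "positive_definite A"
  obtains m where "m > 0" "\<And>v. m * (norm v)\<^sup>2 \<le> v \<bullet> (A *v v)"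
proof -
  have "continuous_on (sphere 0 1) (\<lambda>v. v \<bullet> (A *v v))"
    by (intro continuous_intros continuous_on_inner linear_continuous_on matrix_vector_mul_bounded_linear)
  moreover have "sphere (0 :: real^'n) 1 \<noteq> {}"
    by simp
  ultimately obtain u where u: "u \<in> sphere 0 1" "\<And>v. v \<in> sphere 0 1 \<Longrightarrow> u \<bullet> (A *v u) \<le> v \<bullet> (A *v v)"
    using continuous_attains_inf[OF compact_sphere] by blast
  show thesis
  proof
    show "u \<bullet> (A *v u) > 0"
    proof -
      have "u \<noteq> 0"
        using u(1) by auto
      then show ?thesis
        using assms by (simp add: positive_definite_def)
    qed
    fix v :: "real^'n"
    show "u \<bullet> (A *v u) * (norm v)\<^sup>2 \<le> v \<bullet> (A *v v)"
    proof (cases "v = 0")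
      case False
      have "u \<bullet> (A *v u) \<le> ((1 / norm v) *\<^sub>R v) \<bullet> (A *v ((1 / norm v) *\<^sub>R v))"
        using False by (intro u(2)) simp
      also have "\<dots> = (v \<bullet> (A *v v)) / (norm v)\<^sup>2"
        by (simp add: matrix_vector_mult_scaleR power2_eq_square)
      finally show ?thesis
        using False by (simp add: field_simps)
    qed simp
  qed
qed

context natural_exponential_family
begin

text \<open>For parameters in \<Theta> this is the Kullback-Leibler divergence of the member at
  \<open>\<theta> + h\<close> from the member at \<theta>.\<close>

definition bregman :: "real^'r \<Rightarrow> real^'r \<Rightarrow> real" where
  "bregman \<theta> h = log_partition \<nu> b (\<theta> + h) - log_partition \<nu> b \<theta> - h \<bullet> a' \<theta>"

text \<open>A closed neighbourhood \<open>K1\<close> of \<open>K\<close> is still compact inside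
  \<Theta>, so \<open>a''\<close> is bounded and uniformly continuous there. In the Taylor remainder
  the Hessian at intermediate points may thus be replaced by the one at \<theta>, at a cost of
  \<epsilon>. Uniformity over \<open>K\<close> matters because the parameter varies with the
  regressor.\<close>

lemma bregman_bounds:
  assumes K: "compact K" "K \<subseteq> \<Theta>" and \<epsilon>: "\<epsilon> > 0"
  obtains e C where "e > 0" "C \<ge> 0"
    "\<And>\<theta>. \<theta> \<in> K \<Longrightarrow> norm (a'' \<theta>) \<le> C"
    "\<And>\<theta> h. \<theta> \<in> K \<Longrightarrow> norm h \<le> e \<Longrightarrow> (h \<bullet> (a'' \<theta> *v h) - \<epsilon> * (norm h)\<^sup>2) / 2 \<le> bregman \<theta> h"
    "\<And>\<theta> h1 h2 r. \<theta> \<in> K \<Longrightarrow> r \<le> e \<Longrightarrow> norm h1 \<le> r \<Longrightarrow> norm h2 \<le> r \<Longrightarrow>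
       \<bar>bregman \<theta> h1 - bregman \<theta> h2\<bar> \<le> C * r * norm (h1 - h2)"
proof -
  obtain e0 where e0: "e0 > 0" "{x + y | x y. x \<in> K \<and> y \<in> cball 0 e0} \<subseteq> \<Theta>"
  proof -
    obtain e where "e > 0" "(\<Union>x\<in>K. cball x e) \<subseteq> \<Theta>"
      using compact_subset_open_imp_cball_epsilon_subset[OF K(1) open_U K(2)] .
    then show thesis
      by (intro that[of e]) (fastforce simp: dist_norm)+
  qed
  define K1 where "K1 = {x + y | x y. x \<in> K \<and> y \<in> cball 0 e0}"
  have K1: "compact K1" "K1 \<subseteq> \<Theta>"
    using compact_sums[OF K(1) compact_cball, of 0 e0] e0 by (auto simp: K1_def)
  have in_K1: "z \<in> K1" if "\<theta> \<in> K" "norm (z - \<theta>) \<le> e0" for \<theta> z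
    using that unfolding K1_def by (intro CollectI exI[of _ \<theta>] exI[of _ "z - \<theta>"]) auto
  have cont: "continuous_on K1 a''"
    using continuous_on_hessian continuous_on_subset K1(2) by blast
  obtain C where C: "C > 0" "\<And>z. z \<in> K1 \<Longrightarrow> norm (a'' z) \<le> C"
    using compact_imp_bounded[OF compact_continuous_image[OF cont K1(1)]] unfolding bounded_pos by auto
  obtain e1 where e1: "e1 > 0"
    "\<And>x y. x \<in> K1 \<Longrightarrow> y \<in> K1 \<Longrightarrow> dist y x < e1 \<Longrightarrow> dist (a'' y) (a'' x) < \<epsilon>"
    using compact_uniformly_continuous[OF cont K1(1)] \<epsilon> unfolding uniformly_continuous_on_def by metis
  \<comment> \<open>The bound \<open>e0\<close> keeps segments in \<open>K1\<close>; halving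
    \<open>e1\<close> yields the strict inequality asked for by uniform continuity.\<close>
  define e where "e = min e0 (e1 / 2)"
  have e: "e > 0" "e \<le> e0" "e < e1"
    using e0 e1 by (auto simp: e_def)
  show thesis
  proof
    show "norm (a'' \<theta>) \<le> C" if "\<theta> \<in> K" for \<theta>
      using C(2) in_K1[OF that, of \<theta>] e0 by simp
    fix \<theta> assume \<theta>: "\<theta> \<in> K"
    show "(h \<bullet> (a'' \<theta> *v h) - \<epsilon> * (norm h)\<^sup>2) / 2 \<le> bregman \<theta> h" if h: "norm h \<le> e" for h
    proof -
      let ?q = "h \<bullet> (a'' \<theta> *v h) - \<epsilon> * (norm h)\<^sup>2"
      have th: "norm (t *\<^sub>R h) \<le> e" if "t \<in> {0..1}" for t :: real
        using that h mult_left_le_one_le[of "norm h" t] by simp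
      have "h \<bullet> a' \<theta> + ?q / 2 \<le> log_partition \<nu> b (\<theta> + h) - log_partition \<nu> b \<theta>"
      proof (rule gradient_hessian_taylor_lower[OF derivs])
        fix t :: real assume t: "t \<in> {0..1}"
        have z: "\<theta> + t *\<^sub>R h \<in> K1"
          using th[OF t] e by (intro in_K1[OF \<theta>]) auto
        then show "\<theta> + t *\<^sub>R h \<in> \<Theta>"
          using K1 by auto
        have "norm (a'' (\<theta> + t *\<^sub>R h) - a'' \<theta>) \<le> \<epsilon>"
          using e1(2)[OF in_K1[OF \<theta>, of \<theta>] z] th[OF t] e e0 by (simp add: dist_norm)
        then have "norm (a'' (\<theta> + t *\<^sub>R h) - a'' \<theta>) * (norm h)\<^sup>2 \<le> \<epsilon> * (norm h)\<^sup>2"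
          by (intro mult_right_mono) auto
        then show "?q \<le> h \<bullet> (a'' (\<theta> + t *\<^sub>R h) *v h)"
          using abs_quadratic_form_le[of h "a'' (\<theta> + t *\<^sub>R h) - a'' \<theta>"]
          by (simp add: matrix_vector_mult_diff_rdistrib inner_diff_right)
      qed
      then show ?thesis
        unfolding bregman_def by linarith
    qed
    show "\<bar>bregman \<theta> h1 - bregman \<theta> h2\<bar> \<le> C * r * norm (h1 - h2)"
      if r: "r \<le> e" "norm h1 \<le> r" "norm h2 \<le> r" for r h1 h2
    proof -
      have K1': "cball \<theta> r \<subseteq> K1"
        using in_K1[OF \<theta>] r e by (auto simp: dist_norm norm_minus_commute)
      have "onorm (\<lambda>h. a'' z *v h) \<le> C" if "z \<in> cball \<theta> r" for z
      proof -
        have "norm (a'' z *v h) \<le> C * norm h" for h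
          using norm_matrix_vector_mult_le[of "a'' z" h] mult_right_mono[OF C(2), of z "norm h"] K1' that
          by fastforce
        then show ?thesis
          using C(1) by (intro onorm_bound) auto
      qed
      then have "\<bar>(log_partition \<nu> b (\<theta> + h1) - h1 \<bullet> a' \<theta>) - (log_partition \<nu> b (\<theta> + h2) - h2 \<bullet> a' \<theta>)\<bar>
          \<le> C * r * norm (h1 - h2)"
        using K1' K1(2) r by (intro gradient_hessian_bregman_lipschitz[OF derivs]) auto
      then show ?thesis
        by (simp add: bregman_def algebra_simps)
    qed
  qed (use e C in auto)
qed

end

section \<open>The penalty\<close>

lemma penalty_nonneg:
  assumes "penalty_shape l \<eta>" "penalty_slope_at_zero l \<eta>" "n \<ge> 1"
  shows "0 \<le> \<eta> (l n) x"
  using assms unfolding penalty_shape_def penalty_slope_at_zero_def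
  by (metis abs_ge_zero abs_zero)

text \<open>At the origin, where differentiability fails, continuity follows from the finite limit
  of the quotient by \<open>\<bar>x\<bar>\<close>.\<close>

lemma penalty_continuous:
  assumes P1: "penalty_shape l \<eta>" and P2: "penalty_slope_at_zero l \<eta>" and n: "n \<ge> 1"
  shows "continuous_on UNIV (\<eta> (l n))"
proof (rule continuous_at_imp_continuous_on, rule ballI)
  fix x :: real
  show "isCont (\<eta> (l n)) x"
  proof (cases "x = 0")
    case False
    then show ?thesis
      using P1 n by (auto simp: penalty_shape_def intro: field_differentiable_imp_continuous_at)
  next
    case True
    have "((\<lambda>x. \<eta> (l n) x / \<bar>x\<bar>) \<longlongrightarrow> l n) (at 0)" and 0: "\<eta> (l n) 0 = 0"
      using P2 n by (auto simp: penalty_slope_at_zero_def)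
    then have "((\<lambda>x. \<eta> (l n) x / \<bar>x\<bar> * \<bar>x\<bar>) \<longlongrightarrow> l n * \<bar>0\<bar>) (at 0)"
      by (intro tendsto_intros)
    then have "((\<lambda>x. \<eta> (l n) x / \<bar>x\<bar> * \<bar>x\<bar>) \<longlongrightarrow> 0) (at 0)"
      by simp
    moreover have "eventually (\<lambda>x. \<eta> (l n) x / \<bar>x\<bar> * \<bar>x\<bar> = \<eta> (l n) x) (at 0)"
      unfolding eventually_at_filter by simp
    ultimately have "(\<eta> (l n) \<longlongrightarrow> 0) (at 0)"
      by (rule Lim_transform_eventually)
    then show ?thesis
      using True 0 by (simp add: isCont_def)
  qed
qed

text \<open>A vanishing derivative makes the penalty constant to the right of
  \<open>\<tau> * l n\<close>, and symmetry carries this to the left half-line.\<close>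

lemma penalty_flat_eq:
  assumes P1: "penalty_shape l \<eta>" and n: "n \<ge> 1" and \<tau>: "0 < \<tau> * l n"
    and flat: "\<And>x. \<tau> * l n \<le> \<bar>x\<bar> \<Longrightarrow> deriv (\<eta> (l n)) x = 0"
    and x: "\<tau> * l n \<le> \<bar>x\<bar>" and y: "\<tau> * l n \<le> \<bar>y\<bar>"
  shows "\<eta> (l n) x = \<eta> (l n) y"
proof -
  have const: "\<eta> (l n) u = \<eta> (l n) (\<tau> * l n)" if "\<tau> * l n \<le> u" for u
  proof (cases "\<tau> * l n = u")
    case False
    then have less: "\<tau> * l n < u"
      using that by simp
    have der: "(\<eta> (l n) has_real_derivative 0) (at z)" if "\<tau> * l n \<le> z" for z
    proof -
      \<comment> \<open>A value of \<open>deriv\<close> is informative only at points of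
        differentiability; \<open>0 < \<tau> * l n\<close> keeps \<open>z\<close> away from the
        origin.\<close>
      have "\<eta> (l n) field_differentiable at z"
        using P1 n that \<tau> by (auto simp: penalty_shape_def)
      then show ?thesis
        using flat[of z] that \<tau> by (metis abs_of_nonneg field_differentiable_derivI less_le order_trans)
    qed
    have "continuous_on {\<tau> * l n..u} (\<eta> (l n))"
      using der by (intro continuous_at_imp_continuous_on ballI DERIV_isCont) auto
    then show ?thesis
      using DERIV_isconst_end[OF less] der by simp
  qed simp
  have "\<eta> (l n) u = \<eta> (l n) \<bar>u\<bar>" for u
    using P1 n by (auto simp: penalty_shape_def abs_if)
  then show ?thesis
    using const[OF x] const[OF y] by metis
qed

text \<open>For \<open>n \<ge> 1\<close> the product \<open>n * l\<^sup>2\<close> equals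
  \<open>lam\<^sup>2\<close> times \<open>n powr (\<gamma>0 - 1)\<close>. So
  \<open>\<gamma>0 < 2\<close> lets the tuning parameter vanish, while \<open>\<gamma>0 > 1\<close>
  keeps it above the stochastic order of the averaged score.\<close>

lemma tuning_limits:
  assumes "0 < lam" "1 < \<gamma>0" "\<gamma>0 < 2"
  shows "tuning \<gamma>0 lam \<longlonglongrightarrow> 0"
    and "filterlim (\<lambda>n. real n * (tuning \<gamma>0 lam n)\<^sup>2) at_top sequentially"
    and "n \<ge> 1 \<Longrightarrow> 0 < tuning \<gamma>0 lam n"
proof -
  have "(\<lambda>n. real n powr ((\<gamma>0 - 2) / 2) * lam) \<longlonglongrightarrow> 0 * lam"
    using assms by (intro tendsto_mult tendsto_const tendsto_neg_powr filterlim_real_sequentially) auto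
  then show "tuning \<gamma>0 lam \<longlonglongrightarrow> 0"
    unfolding tuning_def[abs_def] by simp
  have "filterlim (\<lambda>n. inverse (real n powr - (\<gamma>0 - 1))) at_top sequentially"
  proof (rule filterlim_inverse_at_top)
    show "(\<lambda>n. real n powr - (\<gamma>0 - 1)) \<longlonglongrightarrow> 0"
      using assms by (intro tendsto_neg_powr filterlim_real_sequentially) auto
    show "\<forall>\<^sub>F n in sequentially. 0 < real n powr - (\<gamma>0 - 1)"
      using eventually_gt_at_top[of 0] by eventually_elim simp
  qed
  then have "filterlim (\<lambda>n. real n powr (\<gamma>0 - 1)) at_top sequentially"
    by (simp only: powr_minus inverse_inverse_eq)
  then have "filterlim (\<lambda>n. lam\<^sup>2 * real n powr (\<gamma>0 - 1)) at_top sequentially"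
    using assms by (intro filterlim_tendsto_pos_mult_at_top[OF tendsto_const]) auto
  moreover have "eventually (\<lambda>n. lam\<^sup>2 * real n powr (\<gamma>0 - 1) = real n * (tuning \<gamma>0 lam n)\<^sup>2) sequentially"
    using eventually_ge_at_top[of 1]
  proof eventually_elim
    case (elim n)
    have "real n * (real n powr ((\<gamma>0 - 2) / 2))\<^sup>2 = real n powr (1 + ((\<gamma>0 - 2) / 2 + (\<gamma>0 - 2) / 2))"
      using elim by (simp only: powr_add power2_eq_square powr_one_gt_zero_iff) simp
    also have "1 + ((\<gamma>0 - 2) / 2 + (\<gamma>0 - 2) / 2) = \<gamma>0 - 1"
      by simp
    finally show ?case
      by (simp add: tuning_def power_mult_distrib)
  qed
  ultimately show "filterlim (\<lambda>n. real n * (tuning \<gamma>0 lam n)\<^sup>2) at_top sequentially"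
    by (rule filterlim_mono_eventually[OF _ order_refl order_refl])
  show "n \<ge> 1 \<Longrightarrow> 0 < tuning \<gamma>0 lam n"
    using assms by (simp add: tuning_def)
qed

section \<open>Bounds for the negative log-likelihood\<close>

text \<open>This links the matrix limit in (C2) with the Hessian forms at \<open>X i *v v\<close>
  that occur in the Taylor bound.\<close>

lemma information_quadratic_form:
  fixes X :: "nat \<Rightarrow> real^'p^'r" and D :: "nat \<Rightarrow> real^'r^'r"
  shows "v \<bullet> ((c *\<^sub>R (\<Sum>i\<in>I. transpose (X i) ** D i ** X i)) *v v)
    = c * (\<Sum>i\<in>I. (X i *v v) \<bullet> (D i *v (X i *v v)))"
proof -
  have 1: "v \<bullet> ((transpose (X i) ** D i ** X i) *v v) = (X i *v v) \<bullet> (D i *v (X i *v v))" for i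
    by (simp add: matrix_vector_mul_assoc[symmetric] transpose_matrix_vector inner_commute[of v] dot_lmul_matrix)
       (simp add: inner_commute)
  have "v \<bullet> ((\<Sum>i\<in>I. transpose (X i) ** D i ** X i) *v v) = (\<Sum>i\<in>I. (X i *v v) \<bullet> (D i *v (X i *v v)))"
    by (induction I rule: infinite_finite_induct)
       (simp_all add: matrix_vector_mult_add_rdistrib inner_add_right 1)
  then show ?thesis
    by (simp add: scaleR_matrix_vector_assoc[symmetric])
qed

context natural_exponential_family
begin

definition loss :: "(nat \<Rightarrow> real^'p^'r) \<Rightarrow> (nat \<Rightarrow> real^'r) \<Rightarrow> nat \<Rightarrow> real^'p \<Rightarrow> real" where
  "loss X y n \<beta> = - (\<Sum>i<n. log_lik \<nu> b (X i) (y i) \<beta>)"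

text \<open>For \<open>s \<ge> 0\<close> this says that the score at \<open>\<beta>s\<close> has
  Euclidean norm at most \<open>s\<close>; testing it against directions is the form in which the
  loss differences use it.\<close>

definition score_bounded ::
  "(nat \<Rightarrow> real^'p^'r) \<Rightarrow> real^'p \<Rightarrow> (nat \<Rightarrow> real^'r) \<Rightarrow> nat \<Rightarrow> real \<Rightarrow> bool" where
  "score_bounded X \<beta>s y n s \<longleftrightarrow>
     (\<forall>v. \<bar>\<Sum>i<n. (y i - a' (X i *v \<beta>s)) \<bullet> (X i *v v)\<bar> \<le> s * norm v)"

text \<open>Each of the \<open>CARD('p)\<close> coordinates of the score contributes an equal share
  of \<open>s\<close>, so scalar tail bounds suffice.\<close>

lemma score_boundedI:
  fixes X :: "nat \<Rightarrow> real^'p^'r"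
  assumes "\<And>j. \<bar>\<Sum>i<n. y i \<bullet> column j (X i) - column j (X i) \<bullet> a' (X i *v \<beta>s)\<bar> \<le> s / CARD('p)"
  shows "score_bounded X \<beta>s y n s"
  unfolding score_bounded_def
proof
  fix v :: "real^'p"
  let ?W = "\<lambda>j. \<Sum>i<n. y i \<bullet> column j (X i) - column j (X i) \<bullet> a' (X i *v \<beta>s)"
  have "(\<Sum>i<n. (y i - a' (X i *v \<beta>s)) \<bullet> (X i *v v)) =
      (\<Sum>i<n. \<Sum>j\<in>UNIV. v $ j * (y i \<bullet> column j (X i) - column j (X i) \<bullet> a' (X i *v \<beta>s)))"
    by (simp add: matrix_mult_sum[of _ v] inner_sum_right scalar_mult_eq_scaleR inner_diff_left
        inner_commute[of "a' _"])
  also have "\<dots> = (\<Sum>j\<in>UNIV. v $ j * ?W j)"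
    by (subst sum.swap) (simp only: sum_distrib_left)
  finally have "\<bar>\<Sum>i<n. (y i - a' (X i *v \<beta>s)) \<bullet> (X i *v v)\<bar> = \<bar>\<Sum>j\<in>UNIV. v $ j * ?W j\<bar>"
    by simp
  also have "\<dots> \<le> (\<Sum>j\<in>(UNIV::'p set). norm v * (s / CARD('p)))"
  proof (rule order_trans[OF sum_abs sum_mono])
    fix j show "\<bar>v $ j * ?W j\<bar> \<le> norm v * (s / CARD('p))"
      unfolding abs_mult using assms[of j] component_le_norm_cart[of v j] by (intro mult_mono) auto
  qed
  also have "\<dots> = s * norm v"
    by simp
  finally show "\<bar>\<Sum>i<n. (y i - a' (X i *v \<beta>s)) \<bullet> (X i *v v)\<bar> \<le> s * norm v" .
qed

text \<open>The observations \<open>y\<close> enter only through the score term, which is linear in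
  \<open>\<beta> - z\<close>; the Bregman part depends on the regressors alone.\<close>

lemma loss_diff:
  fixes X :: "nat \<Rightarrow> real^'p^'r"
  shows "loss X y n \<beta> - loss X y n z =
    (\<Sum>i<n. bregman (X i *v \<beta>s) (X i *v (\<beta> - \<beta>s)) - bregman (X i *v \<beta>s) (X i *v (z - \<beta>s)))
    - (\<Sum>i<n. (y i - a' (X i *v \<beta>s)) \<bullet> (X i *v (\<beta> - z)))"
proof -
  have shift: "X i *v \<beta>s + X i *v (u - \<beta>s) = X i *v u" for i u
    by (simp add: matrix_vector_mult_diff_distrib)
  have "log_lik \<nu> b (X i) (y i) z - log_lik \<nu> b (X i) (y i) \<beta> =
      (bregman (X i *v \<beta>s) (X i *v (\<beta> - \<beta>s)) - bregman (X i *v \<beta>s) (X i *v (z - \<beta>s)))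
      - (y i - a' (X i *v \<beta>s)) \<bullet> (X i *v (\<beta> - z))" for i
    unfolding bregman_def shift log_lik_def
    by (simp add: matrix_vector_mult_diff_distrib inner_diff_left inner_diff_right inner_commute[of "a' _"])
  then have "(\<Sum>i<n. log_lik \<nu> b (X i) (y i) z - log_lik \<nu> b (X i) (y i) \<beta>) =
      (\<Sum>i<n. (bregman (X i *v \<beta>s) (X i *v (\<beta> - \<beta>s)) - bregman (X i *v \<beta>s) (X i *v (z - \<beta>s)))
      - (y i - a' (X i *v \<beta>s)) \<bullet> (X i *v (\<beta> - z)))"
    by simp
  then show ?thesis
    unfolding loss_def by (simp add: sum_subtractf)
qed

text \<open>Up to terms affine in \<beta>, the loss is a sum of log-partition functions at linear
  images of \<beta>, each convex along the segment.\<close>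

lemma loss_radial:
  fixes X :: "nat \<Rightarrow> real^'p^'r"
  assumes B: "convex B" "\<beta>s \<in> B" "\<beta> \<in> B" and X: "\<And>i \<beta>. \<beta> \<in> B \<Longrightarrow> X i *v \<beta> \<in> \<Theta>"
    and psd: "\<forall>\<theta>\<in>\<Theta>. positive_definite (a'' \<theta>)" and s: "s \<in> {0..1}"
  shows "loss X y n (\<beta>s + s *\<^sub>R (\<beta> - \<beta>s)) \<le> (1 - s) * loss X y n \<beta>s + s * loss X y n \<beta>"
proof -
  have "- log_lik \<nu> b (X i) (y i) (\<beta>s + s *\<^sub>R (\<beta> - \<beta>s)) \<le>
      (1 - s) * - log_lik \<nu> b (X i) (y i) \<beta>s + s * - log_lik \<nu> b (X i) (y i) \<beta>" for i
  proof -
    have eq: "X i *v \<beta>s + t *\<^sub>R (X i *v (\<beta> - \<beta>s)) = X i *v (\<beta>s + t *\<^sub>R (\<beta> - \<beta>s))" for t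
      by (simp add: matrix_vector_right_distrib matrix_vector_mult_scaleR)
    have inB: "\<beta>s + t *\<^sub>R (\<beta> - \<beta>s) \<in> B" if "t \<in> {0..1}" for t
      using convexD_alt[OF B, of t] that by (simp add: algebra_simps)
    have "log_partition \<nu> b (X i *v \<beta>s + s *\<^sub>R (X i *v (\<beta> - \<beta>s))) \<le>
        (1 - s) * log_partition \<nu> b (X i *v \<beta>s) + s * log_partition \<nu> b (X i *v \<beta>s + X i *v (\<beta> - \<beta>s))"
    proof (rule gradient_hessian_convex_segment[OF derivs _ _ s])
      show "X i *v \<beta>s + t *\<^sub>R (X i *v (\<beta> - \<beta>s)) \<in> \<Theta>" if "t \<in> {0..1}" for t
        unfolding eq using X inB[OF that] by blast
      show "0 \<le> h \<bullet> (a'' z *v h)" if "z \<in> \<Theta>" for z h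
        using psd that by (cases "h = 0") (auto simp: positive_definite_def less_imp_le)
    qed
    then show ?thesis
      unfolding eq using eq[of 1] by (simp add: log_lik_def matrix_vector_right_distrib
          matrix_vector_mult_scaleR matrix_vector_mult_diff_distrib inner_add_right inner_diff_right algebra_simps)
  qed
  then have "(\<Sum>i<n. - log_lik \<nu> b (X i) (y i) (\<beta>s + s *\<^sub>R (\<beta> - \<beta>s))) \<le>
      (\<Sum>i<n. (1 - s) * - log_lik \<nu> b (X i) (y i) \<beta>s + s * - log_lik \<nu> b (X i) (y i) \<beta>)"
    by (intro sum_mono)
  then show ?thesis
    unfolding loss_def sum.distrib sum_distrib_left[symmetric] sum_negf .
qed

lemma continuous_on_loss:
  fixes X :: "nat \<Rightarrow> real^'p^'r"
  assumes X: "\<And>i \<beta>. \<beta> \<in> S \<Longrightarrow> X i *v \<beta> \<in> \<Theta>"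
  shows "continuous_on S (loss X y n)"
proof -
  have A: "continuous_on \<Theta> (log_partition \<nu> b)"
    using derivs has_derivative_continuous
    unfolding gradient_hessian_on_def gderiv_def by (blast intro: continuous_at_imp_continuous_on)
  have mv: "continuous_on S (\<lambda>\<beta>. X i *v \<beta>)" for i
    by (intro linear_continuous_on matrix_vector_mul_bounded_linear)
  have "continuous_on S (\<lambda>\<beta>. log_partition \<nu> b (X i *v \<beta>))" for i
    using X by (intro continuous_on_compose2[OF A mv]) auto
  then show ?thesis
    unfolding loss_def log_lik_def by (intro continuous_intros mv)
qed

text \<open>The constants depend on the regressors and \<open>\<beta>s\<close> but not on the
  observations: randomness enters only through \<open>score_bounded\<close>. Curvature comes from
  the limit information, whose least eigenvalue is bounded below by some
  \<open>m > 0\<close>.\<close>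

lemma loss_bounds:
  fixes X :: "nat \<Rightarrow> real^'p^'r" and \<X> :: "(real^'p^'r) set"
  assumes B: "open B" "\<beta>s \<in> B" and X: "\<forall>i. X i \<in> \<X>"
    and C1: "regressors_admissible (natural_parameter_space \<nu> b) \<X> B"
    and C2: "regressors_stable a'' \<X> B X" and r0: "r0 > 0"
  obtains \<rho> c C n0 where "0 < \<rho>" "\<rho> \<le> r0" "cball \<beta>s \<rho> \<subseteq> B" "0 < c" "0 \<le> C"
    "\<And>i j. column j (X i) \<bullet> (a'' (X i *v \<beta>s) *v column j (X i)) \<le> C"
    "\<And>n y s \<beta>. n \<ge> n0 \<Longrightarrow> score_bounded X \<beta>s y n s \<Longrightarrow> \<beta> \<in> cball \<beta>s \<rho> \<Longrightarrow>
       c * n * (norm (\<beta> - \<beta>s))\<^sup>2 - s * norm (\<beta> - \<beta>s) \<le> loss X y n \<beta> - loss X y n \<beta>s"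
    "\<And>n y s r \<beta> z. score_bounded X \<beta>s y n s \<Longrightarrow> r \<le> \<rho> \<Longrightarrow> \<beta> \<in> cball \<beta>s r \<Longrightarrow> z \<in> cball \<beta>s r \<Longrightarrow>
       \<bar>loss X y n \<beta> - loss X y n z\<bar> \<le> (s + C * n * r) * norm (\<beta> - z)"
proof -
  obtain J where J: "positive_definite J"
    "(\<lambda>n. (1 / real n) *\<^sub>R (\<Sum>i<n. transpose (X i) ** a'' (X i *v \<beta>s) ** X i)) \<longlonglongrightarrow> J"
  proof -
    obtain \<mu> where "\<forall>\<beta>\<in>B. positive_definite (limit_information a'' \<mu> \<beta>) \<and>
        (\<lambda>n. (1 / real n) *\<^sub>R (\<Sum>i<n. transpose (X i) ** a'' (X i *v \<beta>) ** X i))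
          \<longlonglongrightarrow> limit_information a'' \<mu> \<beta>"
      using C2 unfolding regressors_stable_def by (elim exE conjE) (rule that)
    then show thesis
      using B(2) by (intro that[of "limit_information a'' \<mu> \<beta>s"]) auto
  qed
  obtain m where m: "m > 0" "\<And>v. m * (norm v)\<^sup>2 \<le> v \<bullet> (J *v v)"
    by (rule positive_definite_lower_bound[OF J(1)]) (rule that)
  have comp: "compact \<X>"
    using C1 by (simp add: regressors_admissible_def)
  obtain R where R: "R > 0" "\<And>Z. Z \<in> \<X> \<Longrightarrow> norm Z \<le> R"
    using compact_imp_bounded[OF comp] unfolding bounded_pos by auto
  have XR: "norm (X i *v v) \<le> R * norm v" for i v
    by (rule order_trans[OF norm_matrix_vector_mult_le]) (use X R in \<open>auto intro: mult_right_mono\<close>)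
  define K where "K = (\<lambda>Z. Z *v \<beta>s) ` \<X>"
  have K: "compact K" "K \<subseteq> \<Theta>"
  proof -
    have "continuous_on \<X> (\<lambda>Z. Z *v \<beta>s)"
      unfolding matrix_vector_mult_def by (intro continuous_intros)
    then show "compact K"
      unfolding K_def using comp by (rule compact_continuous_image)
    show "K \<subseteq> \<Theta>"
      using C1 B(2) by (auto simp: K_def regressors_admissible_def)
  qed
  have XK: "X i *v \<beta>s \<in> K" for i
    using X by (auto simp: K_def)
  \<comment> \<open>Chosen so that the Taylor error at \<open>X i *v v\<close> is at most
    \<open>m / 4 * (norm v)\<^sup>2\<close>.\<close>
  define \<epsilon> where "\<epsilon> = m / (4 * R\<^sup>2)"
  have \<epsilon>: "\<epsilon> > 0" "\<epsilon> * R\<^sup>2 = m / 4"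
    using m R by (auto simp: \<epsilon>_def)
  obtain e C0 where e: "e > 0" and C0: "C0 \<ge> 0"
    and hess: "\<And>\<theta>. \<theta> \<in> K \<Longrightarrow> norm (a'' \<theta>) \<le> C0"
    and breg_low: "\<And>\<theta> h. \<theta> \<in> K \<Longrightarrow> norm h \<le> e \<Longrightarrow>
        (h \<bullet> (a'' \<theta> *v h) - \<epsilon> * (norm h)\<^sup>2) / 2 \<le> bregman \<theta> h"
    and breg_lip: "\<And>\<theta> h1 h2 r. \<theta> \<in> K \<Longrightarrow> r \<le> e \<Longrightarrow> norm h1 \<le> r \<Longrightarrow> norm h2 \<le> r \<Longrightarrow>
       \<bar>bregman \<theta> h1 - bregman \<theta> h2\<bar> \<le> C0 * r * norm (h1 - h2)"
    by (rule bregman_bounds[OF K \<epsilon>(1)]) (rule that)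
  obtain e2 where e2: "e2 > 0" "cball \<beta>s e2 \<subseteq> B"
    using B open_contains_cball by blast
  \<comment> \<open>The three bounds serve the caller's radius, the inclusion in \<open>B\<close>,
    and \<open>norm (X i *v v) \<le> e\<close>.\<close>
  define \<rho> where "\<rho> = min r0 (min e2 (e / R))"
  have \<rho>: "0 < \<rho>" "\<rho> \<le> r0" "\<rho> \<le> e2" "\<rho> \<le> e / R"
    using r0 e2(1) e R(1) by (simp_all add: \<rho>_def)
  then have R\<rho>: "R * \<rho> \<le> e"
    using R(1) by (simp add: field_simps)
  obtain n0 where n0: "\<And>n. n \<ge> n0 \<Longrightarrow>
      norm ((1 / real n) *\<^sub>R (\<Sum>i<n. transpose (X i) ** a'' (X i *v \<beta>s) ** X i) - J) < m / 4"
    using LIMSEQ_D[OF J(2), of "m / 4"] m by auto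
  have info: "n * (3 * m / 4 * (norm v)\<^sup>2) \<le> (\<Sum>i<n. (X i *v v) \<bullet> (a'' (X i *v \<beta>s) *v (X i *v v)))"
    if n: "n \<ge> n0" for n v
  \<comment> \<open>For \<open>n = 0\<close> both sides vanish; otherwise the average can be
    multiplied back by \<open>n\<close>.\<close>
  proof (cases "n = 0")
    case False
    let ?H = "(1 / real n) *\<^sub>R (\<Sum>i<n. transpose (X i) ** a'' (X i *v \<beta>s) ** X i)"
    have "\<bar>v \<bullet> ((?H - J) *v v)\<bar> \<le> m / 4 * (norm v)\<^sup>2"
      using n0[OF n] by (intro order_trans[OF abs_quadratic_form_le] mult_right_mono) auto
    moreover have "v \<bullet> ((?H - J) *v v) = v \<bullet> (?H *v v) - v \<bullet> (J *v v)"
      by (simp only: matrix_vector_mult_diff_rdistrib inner_diff_right)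
    moreover have "3 * m / 4 * (norm v)\<^sup>2 = m * (norm v)\<^sup>2 - m / 4 * (norm v)\<^sup>2"
      by simp
    ultimately have "3 * m / 4 * (norm v)\<^sup>2 \<le> v \<bullet> (?H *v v)"
      using m(2)[of v] by linarith
    then show ?thesis
      using False unfolding information_quadratic_form by (simp add: field_simps)
  qed simp
  show thesis
  proof
    show "0 < \<rho>" "\<rho> \<le> r0" "cball \<beta>s \<rho> \<subseteq> B"
      using \<rho> e2 by (auto intro: order_trans[OF subset_cball])
    show "0 < m / 4" "0 \<le> C0 * R\<^sup>2"
      using m C0 by auto
    show "column j (X i) \<bullet> (a'' (X i *v \<beta>s) *v column j (X i)) \<le> C0 * R\<^sup>2" for i j
    proof -
      have "norm (column j (X i)) \<le> R"
        using XR[of i "axis j 1"] by (simp add: matrix_vector_mult_basis norm_axis_1)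
      then have "norm (a'' (X i *v \<beta>s)) * (norm (column j (X i)))\<^sup>2 \<le> C0 * R\<^sup>2"
        using hess[OF XK] C0 by (intro mult_mono power_mono) auto
      then show ?thesis
        using abs_quadratic_form_le[of "column j (X i)" "a'' (X i *v \<beta>s)"] by linarith
    qed
    fix n y s assume sb: "score_bounded X \<beta>s y n s"
    show "m / 4 * n * (norm (\<beta> - \<beta>s))\<^sup>2 - s * norm (\<beta> - \<beta>s) \<le> loss X y n \<beta> - loss X y n \<beta>s"
      if n: "n \<ge> n0" and \<beta>: "\<beta> \<in> cball \<beta>s \<rho>" for \<beta>
    proof -
      let ?v = "\<beta> - \<beta>s"
      have Xv: "norm (X i *v ?v) \<le> e" for i
      proof -
        have "R * norm ?v \<le> R * \<rho>"
          using \<beta> R by (intro mult_left_mono) (auto simp: dist_norm norm_minus_commute)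
        then show ?thesis
          using XR[of i ?v] R\<rho> by linarith
      qed
      have "((X i *v ?v) \<bullet> (a'' (X i *v \<beta>s) *v (X i *v ?v)) - m / 4 * (norm ?v)\<^sup>2) / 2
          \<le> bregman (X i *v \<beta>s) (X i *v ?v)" for i
      proof -
        have "(norm (X i *v ?v))\<^sup>2 \<le> (R * norm ?v)\<^sup>2"
          using XR by (intro power_mono) auto
        then have "\<epsilon> * (norm (X i *v ?v))\<^sup>2 \<le> \<epsilon> * (R * norm ?v)\<^sup>2"
          using \<epsilon> by (intro mult_left_mono) auto
        also have "\<dots> = m / 4 * (norm ?v)\<^sup>2"
          using \<epsilon>(2) by (simp add: power_mult_distrib mult.assoc[symmetric])
        finally show ?thesis
          by (intro order_trans[OF _ breg_low[OF XK[of i] Xv[of i]]] divide_right_mono diff_left_mono) auto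
      qed
      then have "(\<Sum>i<n. ((X i *v ?v) \<bullet> (a'' (X i *v \<beta>s) *v (X i *v ?v)) - m / 4 * (norm ?v)\<^sup>2) / 2)
          \<le> (\<Sum>i<n. bregman (X i *v \<beta>s) (X i *v ?v))"
        by (intro sum_mono)
      then have "((\<Sum>i<n. (X i *v ?v) \<bullet> (a'' (X i *v \<beta>s) *v (X i *v ?v))) - n * (m / 4 * (norm ?v)\<^sup>2)) / 2
          \<le> (\<Sum>i<n. bregman (X i *v \<beta>s) (X i *v ?v))"
        by (simp add: sum_divide_distrib[symmetric] sum_subtractf)
      \<comment> \<open>The information contributes \<open>3 * m / 4\<close>, the Taylor error takes
        away \<open>m / 4\<close>, and half of the rest is \<open>m / 4\<close>.\<close>
      then have "m / 4 * n * (norm ?v)\<^sup>2 \<le> (\<Sum>i<n. bregman (X i *v \<beta>s) (X i *v ?v))"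
        using info[OF n, of ?v] by (simp add: field_simps)
      moreover have "bregman \<theta> 0 = 0" for \<theta>
        by (simp add: bregman_def)
      moreover have "(\<Sum>i<n. (y i - a' (X i *v \<beta>s)) \<bullet> (X i *v ?v)) \<le> s * norm ?v"
        using sb abs_le_D1 unfolding score_bounded_def by blast
      ultimately show ?thesis
        by (simp add: loss_diff[of X y n \<beta> \<beta>s \<beta>s])
    qed
    show "\<bar>loss X y n \<beta> - loss X y n z\<bar> \<le> (s + C0 * R\<^sup>2 * n * r) * norm (\<beta> - z)"
      if r: "r \<le> \<rho>" and \<beta>: "\<beta> \<in> cball \<beta>s r" "z \<in> cball \<beta>s r" for r \<beta> z
    proof -
      have r_nonneg: "0 \<le> r"
        using \<beta>(1) zero_le_dist[of \<beta>s \<beta>] unfolding mem_cball by linarith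
      have Rr: "R * r \<le> e"
        using R\<rho> mult_left_mono[OF r, of R] R(1) by linarith
      have Xr: "norm (X i *v (u - \<beta>s)) \<le> R * r" if "u \<in> cball \<beta>s r" for u i
        using that R by (intro order_trans[OF XR] mult_left_mono) (auto simp: dist_norm norm_minus_commute)
      have "\<bar>bregman (X i *v \<beta>s) (X i *v (\<beta> - \<beta>s)) - bregman (X i *v \<beta>s) (X i *v (z - \<beta>s))\<bar>
          \<le> C0 * R\<^sup>2 * r * norm (\<beta> - z)" for i
      proof -
        have "X i *v (\<beta> - \<beta>s) - X i *v (z - \<beta>s) = X i *v (\<beta> - z)"
          by (simp add: matrix_vector_mult_diff_distrib)
        then have "\<bar>bregman (X i *v \<beta>s) (X i *v (\<beta> - \<beta>s)) - bregman (X i *v \<beta>s) (X i *v (z - \<beta>s))\<bar>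
          \<le> C0 * (R * r) * norm (X i *v (\<beta> - z))"
          using breg_lip[OF XK[of i] Rr Xr[OF \<beta>(1), of i] Xr[OF \<beta>(2), of i]] by simp
        also have "\<dots> \<le> C0 * (R * r) * (R * norm (\<beta> - z))"
          using XR C0 R r_nonneg by (intro mult_left_mono) auto
        finally show ?thesis
          by (simp add: power2_eq_square mult_ac)
      qed
      then have "\<bar>\<Sum>i<n. bregman (X i *v \<beta>s) (X i *v (\<beta> - \<beta>s)) - bregman (X i *v \<beta>s) (X i *v (z - \<beta>s))\<bar>
          \<le> (\<Sum>i<n. C0 * R\<^sup>2 * r * norm (\<beta> - z))"
        by (intro order_trans[OF sum_abs] sum_mono)
      moreover have "\<bar>\<Sum>i<n. (y i - a' (X i *v \<beta>s)) \<bullet> (X i *v (\<beta> - z))\<bar> \<le> s * norm (\<beta> - z)"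
        using sb unfolding score_bounded_def by blast
      ultimately show ?thesis
        unfolding loss_diff[of X y n \<beta> z \<beta>s] by (intro order_trans[OF abs_triangle_ineq4]) (simp add: algebra_simps)
    qed
  qed
qed

end

section \<open>Sparsity of the estimator\<close>

theorem theorem1:
  fixes \<nu> :: "(real^'r) measure" and b :: "real^'r \<Rightarrow> real"
    and a' :: "real^'r \<Rightarrow> real^'r" and a'' :: "real^'r \<Rightarrow> real^'r^'r"
    and M :: "'w measure" and Y :: "nat \<Rightarrow> 'w \<Rightarrow> real^'r"
    and \<X> :: "(real^'p^'r) set" and X :: "nat \<Rightarrow> real^'p^'r"
    and B :: "(real^'p) set" and \<beta>star :: "real^'p"
    and \<gamma>0 lam :: real and \<eta> :: "real \<Rightarrow> real \<Rightarrow> real"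
    and \<beta>hat :: "nat \<Rightarrow> 'w \<Rightarrow> real^'p"
  assumes base_measure: "sigma_finite_measure \<nu>" "sets \<nu> = sets borel" "b \<in> borel_measurable borel"
    and derivatives: "gradient_hessian_on (interior (natural_parameter_space \<nu> b)) (log_partition \<nu> b) a' a''"
    and variance: "\<forall>\<theta>\<in>interior (natural_parameter_space \<nu> b). positive_definite (a'' \<theta>)"
    and parameters: "open B" "convex B" "\<beta>star \<in> B"
    and regressors: "\<forall>i. X i \<in> \<X>"
    and probability: "prob_space M"
    and independent: "prob_space.indep_vars M (\<lambda>_. borel) Y UNIV"
    and density: "\<forall>i. distributed M \<nu> (Y i) (\<lambda>y. ennreal (nef_density \<nu> b (X i *v \<beta>star) y))"
    and C1: "regressors_admissible (natural_parameter_space \<nu> b) \<X> B"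
    and C2: "regressors_stable a'' \<X> B X"
    and tuning_range: "0 < lam" "1 < \<gamma>0" "\<gamma>0 < 2"
    and P1: "penalty_shape (tuning \<gamma>0 lam) \<eta>"
    and P2: "penalty_slope_at_zero (tuning \<gamma>0 lam) \<eta>"
    and P3: "penalty_vanishing (tuning \<gamma>0 lam) \<eta>"
    and P4: "penalty_eventually_flat (tuning \<gamma>0 lam) \<eta>"
    and estimator: "penalized_mle M \<nu> b B (tuning \<gamma>0 lam) \<eta> X Y \<beta>hat"
  shows "(\<lambda>n. measure M {\<omega> \<in> space M. \<forall>j. \<beta>star $ j = 0 \<longrightarrow> \<beta>hat n \<omega> $ j = 0}) \<longlonglongrightarrow> 1"
proof -
  interpret prob_space M by fact
  interpret natural_exponential_family \<nu> b a' a''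
    using base_measure derivatives by unfold_locales
  define l where "l = tuning \<gamma>0 lam"
  note l_lim = tuning_limits[OF tuning_range, folded l_def]
  have X_\<Theta>: "X i *v \<beta> \<in> \<Theta>" if "\<beta> \<in> B" for i \<beta>
    using C1 regressors that by (auto simp: regressors_admissible_def)
  obtain r0 where r0: "r0 > 0" "\<And>j. \<beta>star $ j \<noteq> 0 \<Longrightarrow> 2 * r0 \<le> \<bar>\<beta>star $ j\<bar>"
  proof
    \<comment> \<open>Inserting 1 keeps the set nonempty when all components of
      \<open>\<beta>star\<close> vanish.\<close>
    let ?S = "insert 1 ((\<lambda>j. \<bar>\<beta>star $ j\<bar>) ` {j. \<beta>star $ j \<noteq> 0})"
    have "finite ?S" by simp
    then show "Min ?S / 2 > 0"
      by (subst zero_less_divide_iff) (auto simp: Min_gr_iff)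
    show "2 * (Min ?S / 2) \<le> \<bar>\<beta>star $ j\<bar>" if "\<beta>star $ j \<noteq> 0" for j
      using that Min_le[OF \<open>finite ?S\<close>, of "\<bar>\<beta>star $ j\<bar>"] by simp
  qed
  obtain \<rho> c C n0 where \<rho>: "0 < \<rho>" "\<rho> \<le> r0" "cball \<beta>star \<rho> \<subseteq> B" and c: "0 < c" and C: "0 \<le> C"
    and var: "\<And>i j. column j (X i) \<bullet> (a'' (X i *v \<beta>star) *v column j (X i)) \<le> C"
    and lower: "\<And>n y s \<beta>. n \<ge> n0 \<Longrightarrow> score_bounded X \<beta>star y n s \<Longrightarrow> \<beta> \<in> cball \<beta>star \<rho> \<Longrightarrow>
       c * n * (norm (\<beta> - \<beta>star))\<^sup>2 - s * norm (\<beta> - \<beta>star) \<le> loss X y n \<beta> - loss X y n \<beta>star"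
    and lip: "\<And>n y s r \<beta> z. score_bounded X \<beta>star y n s \<Longrightarrow> r \<le> \<rho> \<Longrightarrow> \<beta> \<in> cball \<beta>star r \<Longrightarrow>
       z \<in> cball \<beta>star r \<Longrightarrow> \<bar>loss X y n \<beta> - loss X y n z\<bar> \<le> (s + C * n * r) * norm (\<beta> - z)"
    by (rule loss_bounds[OF parameters(1,3) regressors C1 C2 r0(1)]) (rule that)
  obtain \<tau> where \<tau>: "\<tau> > 0" "\<And>n x. n \<ge> 1 \<Longrightarrow> \<tau> * l n \<le> \<bar>x\<bar> \<Longrightarrow> deriv (\<eta> (l n)) x = 0"
    using P4 unfolding penalty_eventually_flat_def l_def by blast
  \<comment> \<open>Relative error \<open>1 / 2\<close> in the uniform limit gives slope at least
    \<open>l n / 2\<close>, with one \<delta> for all sample sizes.\<close>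
  obtain \<delta> where \<delta>: "\<delta> > 0"
    "\<And>n x. n \<ge> 1 \<Longrightarrow> 0 < \<bar>x\<bar> \<Longrightarrow> \<bar>x\<bar> \<le> \<delta> * l n \<Longrightarrow> \<bar>\<eta> (l n) x / \<bar>x\<bar> - l n\<bar> \<le> 1 / 2 * l n"
  proof -
    have "\<forall>\<epsilon>>0. \<exists>\<delta>>0. \<forall>n\<ge>1. \<forall>x. 0 < \<bar>x\<bar> \<and> \<bar>x\<bar> \<le> \<delta> * l n \<longrightarrow> \<bar>\<eta> (l n) x / \<bar>x\<bar> - l n\<bar> \<le> \<epsilon> * l n"
      using P2 unfolding penalty_slope_at_zero_def l_def by (elim conjE)
    from this[rule_format, of "1 / 2"] show thesis
      using that by auto
  qed
  \<comment> \<open>The first bound keeps minimizers within \<open>\<delta> * l n\<close> of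
    \<open>\<beta>star\<close>; the second makes \<open>\<kappa> * (1 + C / c)\<close> at most
    \<open>1 / 4\<close>.\<close>
  define \<kappa> where "\<kappa> = min (c * \<delta>) (1 / (4 * (1 + C / c)))"
  have Cc: "1 + C / c > 0"
    using C c by (simp add: add_pos_nonneg)
  have \<kappa>: "\<kappa> > 0" "\<kappa> \<le> c * \<delta>" "\<kappa> * (1 + C / c) < 1 / 2"
  proof -
    show "\<kappa> > 0" "\<kappa> \<le> c * \<delta>"
      using c \<delta>(1) Cc by (auto simp: \<kappa>_def)
    have "\<kappa> * (1 + C / c) \<le> 1 / (4 * (1 + C / c)) * (1 + C / c)"
      using Cc by (intro mult_right_mono) (auto simp: \<kappa>_def)
    also have "\<dots> < 1 / 2"
      using Cc by simp
    finally show "\<kappa> * (1 + C / c) < 1 / 2" .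
  qed
  \<comment> \<open>Coordinate \<open>j\<close> of the contribution of observation \<open>i\<close>
    to the score at \<open>\<beta>star\<close>; \<open>T n\<close> is the share of one coordinate in
    the bound \<open>\<kappa> * n * l n\<close>.\<close>
  define \<xi> where "\<xi> = (\<lambda>j i \<omega>. Y i \<omega> \<bullet> column j (X i) - column j (X i) \<bullet> a' (X i *v \<beta>star))"
  define T where "T = (\<lambda>n. \<kappa> * real n * l n / CARD('p))"
  define G where "G = (\<lambda>n. {\<omega> \<in> space M. \<forall>j. \<bar>\<Sum>i<n. \<xi> j i \<omega>\<bar> < T n})"
  define A where "A = (\<lambda>n. {\<omega> \<in> space M. \<forall>j. \<beta>star $ j = 0 \<longrightarrow> \<beta>hat n \<omega> $ j = 0})"
  have Y_meas [measurable]: "Y i \<in> borel_measurable M" for i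
    using independent by (auto simp: indep_vars_def)
  have \<xi>_meas [measurable]: "\<xi> j i \<in> borel_measurable M" for i j
    unfolding \<xi>_def by measurable
  have G_sets: "G n \<in> sets M" for n
    unfolding G_def by measurable
  have A_sets: "A n \<in> sets M" if "n \<ge> 1" for n
  proof -
    have [measurable]: "\<beta>hat n \<in> borel_measurable M"
      using estimator that by (auto simp: penalized_mle_def)
    have [measurable]: "(\<lambda>\<omega>. \<beta>hat n \<omega> $ j) \<in> borel_measurable M" for j
      by (rule borel_measurable_continuous_on[of "\<lambda>x. x $ j"]) (auto intro!: continuous_intros)
    show ?thesis
      unfolding A_def by measurable
  qed

  \<comment> \<open>The value at 1 will serve as an upper bound of the whole penalty, since
    eventually 1 lies in the flat range. In this way the pointwise limit in (P3) becomes
    uniform.\<close>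
  have "eventually (\<lambda>n. real CARD('p) * \<eta> (l n) 1 + \<kappa> * l n * \<rho> < c * \<rho>\<^sup>2) sequentially"
  proof (rule order_tendstoD)
    have "(\<lambda>n. \<eta> (l n) 1) \<longlonglongrightarrow> 0"
      using P3 by (simp add: penalty_vanishing_def l_def)
    then show "(\<lambda>n. real CARD('p) * \<eta> (l n) 1 + \<kappa> * l n * \<rho>) \<longlonglongrightarrow> real CARD('p) * 0 + \<kappa> * 0 * \<rho>"
      by (intro tendsto_intros l_lim(1))
    show "real CARD('p) * 0 + \<kappa> * 0 * \<rho> < c * \<rho>\<^sup>2"
      using c \<rho> by simp
  qed
  \<comment> \<open>Below \<open>r0\<close>, the flat range contains the \<rho>-neighbourhoods of
    all nonzero components; below 1, it contains the point 1.\<close>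
  moreover have "eventually (\<lambda>n. \<tau> * l n < min r0 1) sequentially"
  proof (rule order_tendstoD)
    show "(\<lambda>n. \<tau> * l n) \<longlonglongrightarrow> \<tau> * 0"
      by (intro tendsto_intros l_lim(1))
  qed (use r0 in simp)
  ultimately have sub: "eventually (\<lambda>n. G n \<subseteq> A n) sequentially"
    using eventually_ge_at_top[of 1] eventually_ge_at_top[of n0]
  proof eventually_elim
    case (elim n)
    have n: "n \<ge> 1" "n \<ge> n0" and small: "\<tau> * l n < r0" "\<tau> * l n < 1"
      using elim by auto
    have ln: "l n > 0"
      using l_lim(3) n by auto
    note P1' = P1[folded l_def] and P2' = P2[folded l_def]
    have flat: "\<eta> (l n) x = \<eta> (l n) z" if "\<tau> * l n \<le> \<bar>x\<bar>" "\<tau> * l n \<le> \<bar>z\<bar>" for x z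
      using \<tau> ln n that by (intro penalty_flat_eq[OF P1' n(1)]) auto
    have pen_le: "\<eta> (l n) x \<le> \<eta> (l n) 1" for x
    proof (cases "\<bar>x\<bar> \<le> 1")
      case True
      then show ?thesis
        using P1' n by (auto simp: penalty_shape_def)
    qed (use flat[of x 1] small in simp)
    have pen_slope: "l n / 2 * \<bar>x\<bar> \<le> \<eta> (l n) x" if "0 < \<bar>x\<bar>" "\<bar>x\<bar> \<le> \<delta> * l n" for x
    proof -
      have "l n / 2 \<le> \<eta> (l n) x / \<bar>x\<bar>"
        using \<delta>(2)[OF n(1) that] by linarith
      then show ?thesis
        using that(1) by (simp only: pos_le_divide_eq)
    qed
    have pen_flat: "\<eta> (l n) x = \<eta> (l n) (\<beta>star $ j)" if "\<beta>star $ j \<noteq> 0" "\<bar>x - \<beta>star $ j\<bar> \<le> \<rho>" for j x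
      using r0(2)[OF that(1)] that(2) \<rho> small r0(1) by (intro flat) linarith+
    show "G n \<subseteq> A n"
    proof
      fix \<omega> assume \<omega>: "\<omega> \<in> G n"
      let ?y = "\<lambda>i. Y i \<omega>"
      have sb: "score_bounded X \<beta>star ?y n (\<kappa> * n * l n)"
        using \<omega> by (intro score_boundedI) (auto simp: G_def \<xi>_def T_def less_imp_le)
      let ?Q = "\<lambda>\<beta>. loss X ?y n \<beta> + real n * (\<Sum>j\<in>UNIV. \<eta> (l n) (\<beta> $ j))"
      have Q: "penalized_objective \<nu> b (\<eta> (l n)) X ?y n = ?Q"
        by (simp add: penalized_objective_def loss_def fun_eq_iff)
      have sparse: "\<exists>\<beta>. is_arg_min ?Q (\<lambda>\<beta>. \<beta> \<in> B) \<beta>"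
        "\<And>\<beta> j. is_arg_min ?Q (\<lambda>\<beta>. \<beta> \<in> B) \<beta> \<Longrightarrow> \<beta>star $ j = 0 \<Longrightarrow> \<beta> $ j = 0"
      proof -
        have cont: "continuous_on (cball \<beta>star \<rho>) (loss X ?y n)"
          using \<rho>(3) by (intro continuous_on_loss X_\<Theta>) auto
        have radial: "loss X ?y n (\<beta>star + s *\<^sub>R (\<beta> - \<beta>star))
            \<le> (1 - s) * loss X ?y n \<beta>star + s * loss X ?y n \<beta>" if "\<beta> \<in> B" "s \<in> {0..1}" for \<beta> s
          using X_\<Theta> that by (intro loss_radial[OF parameters(2,3)] variance) auto
        note * = penalized_minimizer_sparse[where L = "loss X ?y n" and pen = "\<eta> (l n)" and N = n and l = "l n"
            and c = c and \<kappa> = \<kappa> and C = C and h = "\<eta> (l n) 1" and \<delta> = \<delta>, OF \<rho>(3,1) _ ln c _ C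
            cont radial lower[OF n(2) sb] lip[OF sb] penalty_continuous[OF P1' P2' n(1)] _
            penalty_nonneg[OF P1' P2' n(1)] pen_le pen_flat pen_slope _ \<kappa>(2,3)]
        have hyps: "0 < real n" "0 \<le> \<kappa>" "\<eta> (l n) 0 = 0"
          "real CARD('p) * \<eta> (l n) 1 < c * \<rho>\<^sup>2 - \<kappa> * l n * \<rho>"
          using n \<kappa> P2' elim by (auto simp: penalty_slope_at_zero_def)
        show "\<exists>\<beta>. is_arg_min ?Q (\<lambda>\<beta>. \<beta> \<in> B) \<beta>"
          using *(1) hyps by blast
        show "\<beta> $ j = 0" if "is_arg_min ?Q (\<lambda>\<beta>. \<beta> \<in> B) \<beta>" "\<beta>star $ j = 0" for \<beta> j
          using *(2) hyps that by blast
      qed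
      have "\<omega> \<in> space M"
        using \<omega> by (simp add: G_def)
      \<comment> \<open>The estimator is tied to minimizers only on samples that have one, so the
        existence part of \<open>sparse\<close> enters here.\<close>
      then have "is_arg_min ?Q (\<lambda>\<beta>. \<beta> \<in> B) (\<beta>hat n \<omega>)"
        using estimator sparse(1) n unfolding penalized_mle_def l_def[symmetric] Let_def Q[symmetric] by blast
      then show "\<omega> \<in> A n"
        using sparse(2) \<open>\<omega> \<in> space M\<close> by (auto simp: A_def)
    qed
  qed

  have tail: "prob {\<omega> \<in> space M. T n \<le> \<bar>\<Sum>i<n. \<xi> j i \<omega>\<bar>} \<le> real n * C / (T n)\<^sup>2" if n: "n \<ge> 1" for n j
  proof (rule indep_sum_tail)
    show "indep_vars (\<lambda>_. borel) (\<xi> j) UNIV"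
      unfolding \<xi>_def by (rule indep_vars_compose2[OF independent]) measurable
    note d = density[rule_format] and \<theta> = X_\<Theta>[OF parameters(3)]
    show "integrable M (\<lambda>\<omega>. (\<xi> j i \<omega>)\<^sup>2)" "expectation (\<xi> j i) = 0" "expectation (\<lambda>\<omega>. (\<xi> j i \<omega>)\<^sup>2) \<le> C" for i
      unfolding \<xi>_def using nef_mean[OF d probability \<theta>] nef_square_integrable[OF d probability \<theta>]
        nef_variance[OF d probability \<theta>] var by simp_all
    show "T n > 0"
      using n \<kappa> l_lim(3)[OF n] by (simp add: T_def)
  qed
  \<comment> \<open>A union bound over the coordinates, each contributing
    \<open>n * C / (T n)\<^sup>2\<close>, where \<open>C\<close> now bounds the variances.\<close>
  define K where "K = CARD('p) * (C * (CARD('p))\<^sup>2 / \<kappa>\<^sup>2)"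
  have G_prob: "1 - K / (real n * (l n)\<^sup>2) \<le> prob (G n)" if n: "n \<ge> 1" for n
  proof -
    let ?E = "\<lambda>j. {\<omega> \<in> space M. T n \<le> \<bar>\<Sum>i<n. \<xi> j i \<omega>\<bar>}"
    have E: "?E j \<in> events" for j
      by measurable
    have "space M - G n = (\<Union>j. ?E j)"
      by (auto simp: G_def simp flip: not_less)
    then have "prob (space M - G n) \<le> (\<Sum>j\<in>UNIV. prob (?E j))"
      using E by (simp add: finite_measure_subadditive_finite image_subset_iff)
    also have "\<dots> \<le> (\<Sum>j\<in>(UNIV::'p set). real n * C / (T n)\<^sup>2)"
      by (intro sum_mono tail n)
    also have "\<dots> = K / (real n * (l n)\<^sup>2)"
      using n l_lim(3)[OF n] \<kappa> by (simp add: K_def T_def power2_eq_square field_simps)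
    finally show ?thesis
      using prob_compl[OF G_sets[of n]] by linarith
  qed
  have "(\<lambda>n. K / (real n * (l n)\<^sup>2)) \<longlonglongrightarrow> 0"
    by (rule tendsto_divide_0[OF tendsto_const filterlim_at_top_imp_at_infinity[OF l_lim(2)]])
  then have "(\<lambda>n. 1 - K / (real n * (l n)\<^sup>2)) \<longlonglongrightarrow> 1 - 0"
    by (intro tendsto_intros)
  then have lim: "(\<lambda>n. 1 - K / (real n * (l n)\<^sup>2)) \<longlonglongrightarrow> 1"
    by simp
  have "(\<lambda>n. prob (A n)) \<longlonglongrightarrow> 1"
  proof (rule tendsto_sandwich[OF _ _ lim tendsto_const])
    show "eventually (\<lambda>n. 1 - K / (real n * (l n)\<^sup>2) \<le> prob (A n)) sequentially"
      using sub eventually_ge_at_top[of 1]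
    proof eventually_elim
      case (elim n)
      then show ?case
        using G_prob[of n] finite_measure_mono[OF elim(1) A_sets[of n]] by linarith
    qed
  qed simp
  then show ?thesis
    by (simp only: A_def)
qed

end
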